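(* Let $\mu$ be a Radon measure on $\mathbb{R}^d$ with uniformly discrete support. If $\mu$ is tempered, it is also slowly increasing.
   Context: A Radon measure on $\mathbb{R}^d$ is in general complex and possibly unbounded (a continuous linear functional on $C_{\mathsf{c}}(\mathbb{R}^d)$ with its inductive limit topology); $|\mu|$ is its total variation measure. A set $\Lambda\subset\mathbb{R}^d$ is uniformly discrete if there is some $r>0$ such that the open balls $B_r(x)$, $x\in\Lambda$, are pairwise disjoint. A Radon measure $\mu$ on $\mathbb{R}^d$ is tempered if there is a tempered distribution $T\in\mathcal{S}'(\mathbb{R}^d)$ with $\mu(\varphi)=T(\varphi)$ for all smooth compactly supported $\varphi\in C^\infty_{\mathsf{c}}(\mathbb{R}^d)$; it is slowly increasing if $\int_{\mathbb{R}^d}\frac{\mathrm{d}|\mu|(x)}{1+|P(x)|}<\infty$ for some polynomial $P\in\mathbb{C}[x_1,\ldots,x_d]$. *)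

theory Defs
  imports "HOL-Analysis.Analysis" "HOL-Library.Poly_Mapping"
begin

section \<open>Function spaces and their topologies\<close>

definition linear_functional_on ::
    "('a \<Rightarrow> complex) set \<Rightarrow> (('a \<Rightarrow> complex) \<Rightarrow> complex) \<Rightarrow> bool" where
  "linear_functional_on S \<mu> \<longleftrightarrow>
     (\<forall>f\<in>S. \<forall>g\<in>S. \<mu> (\<lambda>x. f x + g x) = \<mu> f + \<mu> g) \<and>
     (\<forall>f\<in>S. \<forall>c. \<mu> (\<lambda>x. c * f x) = c * \<mu> f)"

definition fsupport :: "('a::topological_space \<Rightarrow> complex) \<Rightarrow> 'a set" where
  "fsupport f = closure (support_on UNIV f)"

definition Cc :: "('a::topological_space \<Rightarrow> complex) set" where
  "Cc = {f. continuous_on UNIV f \<and> compact (fsupport f)}"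

definition absolutely_convex :: "('a \<Rightarrow> complex) set \<Rightarrow> bool" where
  "absolutely_convex V \<longleftrightarrow>
     (\<forall>f\<in>V. \<forall>g\<in>V. \<forall>a b. norm a + norm b \<le> 1 \<longrightarrow> (\<lambda>x. a * f x + b * g x) \<in> V)"

text \<open>
  The inductive limit topology is the finest locally convex topology on \<open>Cc\<close> for which the
  inclusion of every space \<open>C_K\<close> (functions with support in the compact set \<open>K\<close>, with the
  supremum norm) is continuous. A base of its neighbourhoods of 0 consists of the absolutely convex
  sets whose trace on every \<open>C_K\<close> is a neighbourhood of 0 there.
\<close>

definition Cc_nbhd0 :: "('a::topological_space \<Rightarrow> complex) set \<Rightarrow> bool" where
  "Cc_nbhd0 V \<longleftrightarrow> V \<subseteq> Cc \<and> absolutely_convex V \<and>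
     (\<forall>K. compact K \<longrightarrow>
        (\<exists>e>0. \<forall>f\<in>Cc. fsupport f \<subseteq> K \<and> (\<forall>x. norm (f x) < e) \<longrightarrow> f \<in> V))"

definition Cc_topology :: "('a::topological_space \<Rightarrow> complex) topology" where
  "Cc_topology =
     topology (\<lambda>W. W \<subseteq> Cc \<and> (\<forall>f\<in>W. \<exists>V. Cc_nbhd0 V \<and> (\<forall>g\<in>V. (\<lambda>x. f x + g x) \<in> W)))"

lemma Cc_nbhd0_Int:
  assumes "Cc_nbhd0 V" and "Cc_nbhd0 W"
  shows "Cc_nbhd0 (V \<inter> W)"
proof -
  have "\<exists>e>0. \<forall>f\<in>Cc. fsupport f \<subseteq> K \<and> (\<forall>x. norm (f x) < e) \<longrightarrow> f \<in> V \<inter> W"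
    if "compact K" for K
  proof -
    from assms(1) that have "\<exists>d>0. \<forall>f\<in>Cc. fsupport f \<subseteq> K \<and> (\<forall>x. norm (f x) < d) \<longrightarrow> f \<in> V"
      unfolding Cc_nbhd0_def by simp
    then obtain d where d: "d > 0"
      "\<forall>f\<in>Cc. fsupport f \<subseteq> K \<and> (\<forall>x. norm (f x) < d) \<longrightarrow> f \<in> V"
      by (elim exE conjE)
    from assms(2) that have "\<exists>e>0. \<forall>f\<in>Cc. fsupport f \<subseteq> K \<and> (\<forall>x. norm (f x) < e) \<longrightarrow> f \<in> W"
      unfolding Cc_nbhd0_def by simp
    then obtain e where e: "e > 0"
      "\<forall>f\<in>Cc. fsupport f \<subseteq> K \<and> (\<forall>x. norm (f x) < e) \<longrightarrow> f \<in> W"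
      by (elim exE conjE)
    show ?thesis
      by (rule exI[of _ "min d e"]) (use d e in simp)
  qed
  moreover have "absolutely_convex (V \<inter> W)"
    using assms by (simp add: Cc_nbhd0_def absolutely_convex_def)
  moreover have "V \<inter> W \<subseteq> Cc"
    using assms by (auto simp: Cc_nbhd0_def)
  ultimately show ?thesis
    by (simp add: Cc_nbhd0_def)
qed

lemma openin_Cc_topology:
  "openin Cc_topology W \<longleftrightarrow>
     W \<subseteq> Cc \<and> (\<forall>f\<in>W. \<exists>V. Cc_nbhd0 V \<and> (\<forall>g\<in>V. (\<lambda>x. f x + g x) \<in> W))"
proof -
  have "istopology (\<lambda>W. W \<subseteq> Cc \<and>
     (\<forall>f\<in>W. \<exists>V. Cc_nbhd0 V \<and> (\<forall>g\<in>V. (\<lambda>x. f x + g x) \<in> W)))"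
    (is "istopology ?P")
    unfolding istopology_def
  proof (rule conjI; intro allI impI)
    fix S T assume S: "?P S" and T: "?P T"
    have "\<exists>V. Cc_nbhd0 V \<and> (\<forall>g\<in>V. (\<lambda>x. f x + g x) \<in> S \<inter> T)" if "f \<in> S \<inter> T" for f
    proof -
      obtain V where V: "Cc_nbhd0 V" "\<forall>g\<in>V. (\<lambda>x. f x + g x) \<in> S"
        using conjunct2[OF S] \<open>f \<in> S \<inter> T\<close> by (meson IntD1)
      obtain W where W: "Cc_nbhd0 W" "\<forall>g\<in>W. (\<lambda>x. f x + g x) \<in> T"
        using conjunct2[OF T] \<open>f \<in> S \<inter> T\<close> by (meson IntD2)
      show ?thesis
        by (rule exI[of _ "V \<inter> W"]) (use V W Cc_nbhd0_Int in auto)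
    qed
    moreover have "S \<inter> T \<subseteq> Cc" using S by auto
    ultimately show "?P (S \<inter> T)" by simp
  next
    fix \<K> assume "\<forall>S\<in>\<K>. ?P S"
    then show "?P (\<Union>\<K>)" by (meson UnionE UnionI Union_least)
  qed
  then show ?thesis
    unfolding Cc_topology_def by (subst topology_inverse') auto
qed

definition partial_deriv ::
    "'d \<Rightarrow> (real^'d::finite \<Rightarrow> complex) \<Rightarrow> real^'d \<Rightarrow> complex" where
  "partial_deriv i f x = frechet_derivative f (at x) (axis i 1)"

text \<open>
  A list of coordinate indices stands for the multi-index that counts its entries.
  For smooth functions the order of the entries is irrelevant.
\<close>

primrec iter_partial ::
    "'d list \<Rightarrow> (real^'d::finite \<Rightarrow> complex) \<Rightarrow> real^'d \<Rightarrow> complex" where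
  "iter_partial [] f = f"
| "iter_partial (i # is) f = partial_deriv i (iter_partial is f)"

definition smooth :: "(real^'d::finite \<Rightarrow> complex) \<Rightarrow> bool" where
  "smooth f \<longleftrightarrow> (\<forall>is x. iter_partial is f differentiable (at x))"

definition monomial_fun :: "('d \<Rightarrow> nat) \<Rightarrow> real^'d::finite \<Rightarrow> real" where
  "monomial_fun \<alpha> x = (\<Prod>i\<in>UNIV. (x $ i) ^ \<alpha> i)"

definition schwartz :: "(real^'d::finite \<Rightarrow> complex) set" where
  "schwartz =
     {f. smooth f \<and> (\<forall>\<alpha> is. bounded (range (\<lambda>x. monomial_fun \<alpha> x *\<^sub>R iter_partial is f x)))}"

definition schwartz_seminorm ::
    "('d \<Rightarrow> nat) \<Rightarrow> 'd list \<Rightarrow> (real^'d::finite \<Rightarrow> complex) \<Rightarrow> real" where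
  "schwartz_seminorm \<alpha> is f = (SUP x. norm (monomial_fun \<alpha> x *\<^sub>R iter_partial is f x))"

definition schwartz_topology :: "(real^'d::finite \<Rightarrow> complex) topology" where
  "schwartz_topology = topology_generated_by
     {{g \<in> schwartz. schwartz_seminorm \<alpha> is (\<lambda>x. g x - f x) < e} | f \<alpha> is e.
        f \<in> schwartz \<and> e > 0}"

definition tempered_distribution :: "((real^'d::finite \<Rightarrow> complex) \<Rightarrow> complex) \<Rightarrow> bool" where
  "tempered_distribution T \<longleftrightarrow>
     linear_functional_on schwartz T \<and> continuous_map schwartz_topology euclidean T"


section \<open>Radon measures\<close>

text \<open>
  Functionals are total functions on \<open>'a \<Rightarrow> complex\<close>; for a Radon measure only the values
  on \<open>Cc\<close> are meaningful, and no definition below depends on any others.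
\<close>

definition radon_measure :: "(('a::topological_space \<Rightarrow> complex) \<Rightarrow> complex) \<Rightarrow> bool" where
  "radon_measure \<mu> \<longleftrightarrow> linear_functional_on Cc \<mu> \<and> continuous_map Cc_topology euclidean \<mu>"

definition measure_support :: "(('a::topological_space \<Rightarrow> complex) \<Rightarrow> complex) \<Rightarrow> 'a set" where
  "measure_support \<mu> = - \<Union>{U. open U \<and> (\<forall>f\<in>Cc. fsupport f \<subseteq> U \<longrightarrow> \<mu> f = 0)}"

text \<open>
  The total variation as a positive Borel measure: it is the measure that the Riesz representation
  theorem assigns to the functional sending a nonnegative \<open>f\<close> in \<open>Cc\<close> to the supremum of
  \<open>norm (\<mu> g)\<close> over all \<open>g\<close> in \<open>Cc\<close> with \<open>norm (g x) \<le> f x\<close> for all \<open>x\<close>. On open sets, taking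
  the further supremum over \<open>f \<le> 1\<close> with support in \<open>U\<close> gives the following formula, and
  the value on a Borel set is determined by outer regularity.
\<close>

definition total_variation_open ::
    "(('a::topological_space \<Rightarrow> complex) \<Rightarrow> complex) \<Rightarrow> 'a set \<Rightarrow> ennreal" where
  "total_variation_open \<mu> U =
     (SUP f\<in>{f\<in>Cc. fsupport f \<subseteq> U \<and> (\<forall>x. norm (f x) \<le> 1)}. ennreal (norm (\<mu> f)))"

definition total_variation ::
    "(('a::topological_space \<Rightarrow> complex) \<Rightarrow> complex) \<Rightarrow> 'a measure" where
  "total_variation \<mu> = measure_of UNIV (sets borel)
     (\<lambda>A. INF U\<in>{U. open U \<and> A \<subseteq> U}. total_variation_open \<mu> U)"

definition tempered_measure :: "((real^'d::finite \<Rightarrow> complex) \<Rightarrow> complex) \<Rightarrow> bool" where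
  "tempered_measure \<mu> \<longleftrightarrow>
     (\<exists>T. tempered_distribution T \<and> (\<forall>\<phi>\<in>Cc. smooth \<phi> \<longrightarrow> \<mu> \<phi> = T \<phi>))"

text \<open>
  An element of \<open>('d \<Rightarrow>\<^sub>0 nat) \<Rightarrow>\<^sub>0 complex\<close> is a complex polynomial in variables
  indexed by \<open>'d\<close>: a finitely supported assignment of coefficients to exponent vectors.
\<close>

definition poly_eval :: "(('d \<Rightarrow>\<^sub>0 nat) \<Rightarrow>\<^sub>0 complex) \<Rightarrow> real^'d::finite \<Rightarrow> complex" where
  "poly_eval P x = (\<Sum>m\<in>Poly_Mapping.keys P.
     Poly_Mapping.lookup P m * of_real (monomial_fun (Poly_Mapping.lookup m) x))"

definition slowly_increasing :: "((real^'d::finite \<Rightarrow> complex) \<Rightarrow> complex) \<Rightarrow> bool" where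
  "slowly_increasing \<mu> \<longleftrightarrow>
     (\<exists>P :: ('d \<Rightarrow>\<^sub>0 nat) \<Rightarrow>\<^sub>0 complex.
        (\<integral>\<^sup>+ x. ennreal (1 / (1 + norm (poly_eval P x))) \<partial>total_variation \<mu>) < \<infinity>)"

definition uniformly_discrete :: "'a::metric_space set \<Rightarrow> bool" where
  "uniformly_discrete \<Lambda> \<longleftrightarrow> (\<exists>r>0. disjoint_family_on (\<lambda>x. ball x r) \<Lambda>)"

end

theory Submission
  imports Defs "HOL-Computational_Algebra.Polynomial"
begin

text \<open>
  The support \<open>\<Lambda>\<close> of \<open>\<mu>\<close> is uniformly discrete, so every \<open>x\<close> in \<open>\<Lambda>\<close> is the only point of \<open>\<Lambda>\<close> in a ball
  whose radius \<open>r\<close> does not depend on \<open>x\<close>. A Radon measure does not see a test function that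
  vanishes on its support (\<open>radon_measure_determined_by_support\<close>), hence inside this ball \<open>\<mu>\<close> is a
  multiple of the point mass at \<open>x\<close>. The multiple is \<open>\<mu> \<phi>\<close> for any test function \<open>\<phi>\<close>
  supported in the ball with \<open>\<phi> x = 1\<close>, and its absolute value bounds the total variation of \<open>{x}\<close>
  (\<open>mass_near_isolated_point\<close>).

  Take for \<open>\<phi>\<close> the translates to \<open>x\<close> of one fixed smooth bump. On these \<open>\<mu>\<close> agrees with a
  tempered distribution, which is bounded by finitely many Schwartz seminorms
  (\<open>tempered_distribution_bound\<close>). Under translation to \<open>x\<close> the derivatives of the bump do not change in
  size and the monomials grow polynomially, so the mass of \<open>{x}\<close> is at most a constant times
  \<open>q x ^ N\<close>, where \<open>q x\<close> is the product of the factors \<open>1 + (x $ i)\<^sup>2\<close>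
  (\<open>tensor_bump_bounded_by_weight\<close>).

  Dividing by a polynomial comparable to \<open>q ^ Suc N\<close> leaves the sum of \<open>1 / q x\<close> over
  \<open>\<Lambda>\<close>, which is finite since a uniformly discrete set is no denser than a lattice
  (\<open>uniformly_discrete_summable\<close>).
\<close>

section \<open>Radon measures and their supports\<close>

lemma linear_functional_zero:
  assumes "linear_functional_on S \<mu>" "f \<in> S"
  shows "\<mu> (\<lambda>x. 0) = 0"
proof -
  have "\<mu> (\<lambda>x. 0 * f x) = 0 * \<mu> f"
    using assms unfolding linear_functional_on_def by blast
  then show ?thesis by simp
qed

lemma linear_functional_scale:
  assumes "linear_functional_on S \<mu>" "f \<in> S"
  shows "\<mu> (\<lambda>x. c * f x) = c * \<mu> f"
  using assms unfolding linear_functional_on_def by blast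

lemma linear_functional_add:
  assumes "linear_functional_on S \<mu>" "f \<in> S" "g \<in> S"
  shows "\<mu> (\<lambda>x. f x + g x) = \<mu> f + \<mu> g"
  using assms unfolding linear_functional_on_def by blast

lemma mem_CcI:
  fixes f :: "'a::metric_space \<Rightarrow> complex"
  assumes "continuous_on UNIV f" "compact K" "\<And>x. x \<notin> K \<Longrightarrow> f x = 0"
  shows "f \<in> Cc" "fsupport f \<subseteq> K"
proof -
  have "support_on UNIV f \<subseteq> K"
    using assms(3) by (auto simp: support_on_def)
  then show sub: "fsupport f \<subseteq> K"
    unfolding fsupport_def using assms(2) by (simp add: closure_minimal compact_imp_closed)
  have "compact (fsupport f)"
    using compact_Int_closed[OF assms(2), of "fsupport f"] sub by (simp add: fsupport_def Int_absorb1)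
  then show "f \<in> Cc"
    using assms(1) by (simp add: Cc_def)
qed

lemma not_in_fsupport: "x \<notin> fsupport f \<Longrightarrow> f x = 0"
  using closure_subset[of "support_on UNIV f"]
  by (auto simp: fsupport_def support_on_def)

lemma Cc_continuous: "f \<in> Cc \<Longrightarrow> continuous_on UNIV f"
  and Cc_compact_fsupport: "f \<in> Cc \<Longrightarrow> compact (fsupport f)"
  by (auto simp: Cc_def)

lemma Cc_zero: "(\<lambda>x. 0) \<in> Cc"
  by (auto simp: Cc_def fsupport_def support_on_def)

lemma Cc_add:
  fixes f :: "'a::metric_space \<Rightarrow> complex"
  assumes "f \<in> Cc" "g \<in> Cc"
  shows "(\<lambda>x. f x + g x) \<in> Cc"
  using assms
  by (intro mem_CcI(1)[where K = "fsupport f \<union> fsupport g"])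
     (auto intro!: continuous_intros simp: Cc_continuous Cc_compact_fsupport not_in_fsupport)

lemma Cc_scale:
  fixes f :: "'a::metric_space \<Rightarrow> complex"
  assumes "f \<in> Cc"
  shows "(\<lambda>x. c * f x) \<in> Cc"
  using assms
  by (intro mem_CcI(1)[where K = "fsupport f"])
     (auto intro!: continuous_intros simp: Cc_continuous Cc_compact_fsupport not_in_fsupport)

lemma linear_functional_Cc_diff:
  fixes f :: "'a::metric_space \<Rightarrow> complex"
  assumes "linear_functional_on Cc \<mu>" "f \<in> Cc" "g \<in> Cc"
  shows "\<mu> (\<lambda>x. f x - g x) = \<mu> f - \<mu> g"
  using linear_functional_add[OF assms(1,2) Cc_scale[OF assms(3), of "-1"]]
    linear_functional_scale[OF assms(1,3), of "-1"] by simp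

lemma linear_functional_Cc_sum:
  fixes f :: "'i \<Rightarrow> 'a::metric_space \<Rightarrow> complex"
  assumes "linear_functional_on Cc \<mu>" "finite I" "\<And>i. i \<in> I \<Longrightarrow> f i \<in> Cc"
  shows "(\<lambda>x. \<Sum>i\<in>I. f i x) \<in> Cc \<and> \<mu> (\<lambda>x. \<Sum>i\<in>I. f i x) = (\<Sum>i\<in>I. \<mu> (f i))"
  using assms(2,3)
proof (induction I rule: finite_induct)
  case empty
  then show ?case
    using linear_functional_zero[OF assms(1) Cc_zero] by (simp add: Cc_zero)
next
  case (insert i I)
  then show ?case
    using linear_functional_add[OF assms(1), of "f i" "\<lambda>x. \<Sum>i\<in>I. f i x"]
    by (simp add: Cc_add)
qed

lemma radon_measure_continuous_at_0:
  fixes \<mu> :: "('a::metric_space \<Rightarrow> complex) \<Rightarrow> complex"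
  assumes "radon_measure \<mu>" "compact K" "\<epsilon> > 0"
  obtains e where "e > 0"
    "\<And>f. f \<in> Cc \<Longrightarrow> fsupport f \<subseteq> K \<Longrightarrow> (\<And>x. norm (f x) < e) \<Longrightarrow> norm (\<mu> f) < \<epsilon>"
proof -
  have lin: "linear_functional_on Cc \<mu>" and cont: "continuous_map Cc_topology euclidean \<mu>"
    using assms(1) by (auto simp: radon_measure_def)
  define W where "W = {f \<in> topspace Cc_topology. \<mu> f \<in> ball 0 \<epsilon>}"
  have op: "openin Cc_topology W"
    unfolding W_def using openin_continuous_map_preimage[OF cont, of "ball 0 \<epsilon>"] by simp
  \<comment> \<open>The whole of \<open>Cc\<close> is open, so 0 is a point of the topological space.\<close>
  have "openin Cc_topology (Cc :: ('a \<Rightarrow> complex) set)"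
    unfolding openin_Cc_topology
  proof (intro conjI ballI)
    fix f :: "'a \<Rightarrow> complex" assume f: "f \<in> Cc"
    have "absolutely_convex (Cc :: ('a \<Rightarrow> complex) set)"
      unfolding absolutely_convex_def by (intro ballI allI impI Cc_add Cc_scale)
    then have "Cc_nbhd0 (Cc :: ('a \<Rightarrow> complex) set)"
      unfolding Cc_nbhd0_def by (auto intro: exI[of _ "1::real"])
    then show "\<exists>V. Cc_nbhd0 V \<and> (\<forall>g\<in>V. (\<lambda>x. f x + g x) \<in> Cc)"
      using f Cc_add by blast
  qed auto
  then have "(\<lambda>x. 0) \<in> topspace (Cc_topology :: ('a \<Rightarrow> complex) topology)"
    using Cc_zero openin_subset by blast
  then have "(\<lambda>x. 0) \<in> W"
    using linear_functional_zero[OF lin Cc_zero] assms(3) by (simp add: W_def)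
  then obtain V where V: "Cc_nbhd0 V" "\<And>g. g \<in> V \<Longrightarrow> (\<lambda>x. 0 + g x) \<in> W"
    using op unfolding openin_Cc_topology by meson
  obtain e where "e > 0" "\<forall>f\<in>Cc. fsupport f \<subseteq> K \<and> (\<forall>x. norm (f x) < e) \<longrightarrow> f \<in> V"
    using V(1) assms(2) unfolding Cc_nbhd0_def by meson
  then show ?thesis
    using V(2) by (intro that[of e]) (auto simp: W_def)
qed

text \<open>
  Continuity lets a test function that merely vanishes outside an open set be replaced by one with
  compact support inside that set: subtracting from \<open>f\<close> its radial projection \<open>h\<close> to a small disc
  changes \<open>f\<close> by little and leaves a function supported where \<open>norm (f x)\<close> is bounded below, which
  is a compact subset of \<open>{x. f x \<noteq> 0}\<close>.
\<close>

lemma radon_measure_vanishes_of_smaller_support: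
  fixes \<mu> :: "('a::metric_space \<Rightarrow> complex) \<Rightarrow> complex"
  assumes "radon_measure \<mu>" and f: "f \<in> Cc"
    and small: "\<And>g. g \<in> Cc \<Longrightarrow> fsupport g \<subseteq> {x. f x \<noteq> 0} \<Longrightarrow> \<mu> g = 0"
  shows "\<mu> f = 0"
proof (rule ccontr)
  assume "\<mu> f \<noteq> 0"
  then have pos: "norm (\<mu> f) > 0" by simp
  have lin: "linear_functional_on Cc \<mu>"
    using assms(1) by (simp add: radon_measure_def)
  note fc = Cc_continuous[OF f]
  obtain e where e: "e > 0"
    "\<And>g. g \<in> Cc \<Longrightarrow> fsupport g \<subseteq> fsupport f \<Longrightarrow> (\<And>x. norm (g x) < e) \<Longrightarrow>
       norm (\<mu> g) < norm (\<mu> f)"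
    using radon_measure_continuous_at_0[OF assms(1) Cc_compact_fsupport[OF f] pos] by metis
  define d where "d = e / 2"
  have d: "d > 0" "d < e" using e(1) by (auto simp: d_def)
  \<comment> \<open>The radial projection of \<open>f\<close> to the disc of radius \<open>d\<close>.\<close>
  define h where "h = (\<lambda>x. f x * of_real (d / max d (norm (f x))))"
  have hc: "continuous_on UNIV h"
    unfolding h_def using d fc by (intro continuous_intros) auto
  have h0: "h x = 0" if "x \<notin> fsupport f" for x
    using not_in_fsupport[OF that] by (simp add: h_def)
  note h = mem_CcI[OF hc Cc_compact_fsupport[OF f] h0]
  have hsmall: "norm (h x) < e" for x
  proof -
    have "norm (h x) \<le> d"
      using d(1) by (auto simp: h_def norm_mult norm_divide max_def)
    then show ?thesis using d(2) by simp
  qed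
  have ge: "f x - h x = 0" if "norm (f x) < d" for x
    using d(1) that by (auto simp: h_def max_def)
  have gc: "continuous_on UNIV (\<lambda>x. f x - h x)"
    using fc hc by (intro continuous_intros)
  have "compact (fsupport f \<inter> {x. d \<le> norm (f x)})"
    by (intro compact_Int_closed Cc_compact_fsupport f closed_Collect_le continuous_intros fc)
  moreover have "f x - h x = 0" if "x \<notin> fsupport f \<inter> {x. d \<le> norm (f x)}" for x
  proof (cases "x \<in> fsupport f")
    case True
    then show ?thesis using that by (intro ge) auto
  next
    case False
    then show ?thesis by (simp add: not_in_fsupport h0)
  qed
  ultimately have g: "(\<lambda>x. f x - h x) \<in> Cc"
      "fsupport (\<lambda>x. f x - h x) \<subseteq> fsupport f \<inter> {x. d \<le> norm (f x)}"
    using mem_CcI[OF gc] by metis+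
  have "\<mu> (\<lambda>x. f x - h x) = 0"
    by (rule small[OF g(1)]) (use g(2) d(1) in auto)
  then have "\<mu> f = \<mu> h"
    using linear_functional_Cc_diff[OF lin f h(1)] by simp
  moreover have "norm (\<mu> h) < norm (\<mu> f)"
    by (rule e(2)[OF h hsmall])
  ultimately show False by simp
qed

text \<open>
  The support is defined through the open sets on which \<open>\<mu>\<close> vanishes one at a time; that \<open>\<mu>\<close> also
  vanishes on their union follows by cutting \<open>g\<close> into pieces with a partition of unity for finitely
  many of these sets, which cover the compact support of \<open>g\<close>. The pieces vanish outside
  the sets of the cover without being supported inside them, and the previous lemma bridges this gap.
\<close>

lemma radon_measure_vanishes_off_support:
  fixes \<mu> :: "('a::metric_space \<Rightarrow> complex) \<Rightarrow> complex"
  assumes "radon_measure \<mu>" and g: "g \<in> Cc" and "fsupport g \<subseteq> - measure_support \<mu>"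
  shows "\<mu> g = 0"
proof -
  have lin: "linear_functional_on Cc \<mu>"
    using assms(1) by (simp add: radon_measure_def)
  define \<U> where "\<U> = {U. open U \<and> (\<forall>f\<in>Cc. fsupport f \<subseteq> U \<longrightarrow> \<mu> f = 0)}"
  have cover: "fsupport g \<subseteq> \<Union>\<U>" and op: "\<And>U. U \<in> \<U> \<Longrightarrow> open U"
    using assms(3) by (auto simp: measure_support_def \<U>_def)
  obtain \<D> where \<D>: "\<D> \<subseteq> \<U>" "finite \<D>" "fsupport g \<subseteq> \<Union>\<D>"
    using compactE[OF Cc_compact_fsupport[OF g] cover op] by blast
  \<comment> \<open>The complement of the support of \<open>g\<close> completes the cover, so that the weights sum to 1 everywhere.\<close>
  define \<C> where "\<C> = insert (- fsupport g) \<D>"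
  have finC: "finite \<C>" using \<D> by (simp add: \<C>_def)
  have opC: "\<And>T. T \<in> \<C> \<Longrightarrow> open T"
    using \<D>(1) op by (auto simp: \<C>_def fsupport_def)
  obtain F :: "'a set \<Rightarrow> 'a \<Rightarrow> real"
    where F: "\<And>U. U \<in> \<C> \<Longrightarrow> continuous_on UNIV (F U) \<and> (\<forall>x \<in> UNIV. 0 \<le> F U x)"
      and F0: "\<And>x U. \<lbrakk>U \<in> \<C>; x \<in> UNIV; x \<notin> U\<rbrakk> \<Longrightarrow> F U x = 0"
      and F1: "\<And>x. x \<in> UNIV \<Longrightarrow> supp_sum (\<lambda>W. F W x) \<C> = 1"
  proof (rule subordinate_partition_of_unity[of UNIV \<C>])
    show "UNIV \<subseteq> \<Union>\<C>" using \<D>(3) by (auto simp: \<C>_def)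
  next
    fix x :: 'a
    show "\<exists>V. open V \<and> x \<in> V \<and> finite {U \<in> \<C>. U \<inter> V \<noteq> {}}"
      by (rule exI[of _ UNIV]) (use finC in auto)
  qed (use opC in auto)
  have sum1: "(\<Sum>U\<in>\<C>. F U x) = 1" for x
  proof -
    have "(\<Sum>U\<in>support_on \<C> (\<lambda>W. F W x). F U x) = (\<Sum>U\<in>\<C>. F U x)"
      by (rule sum.mono_neutral_left[OF finC]) (auto simp: support_on_def)
    then show ?thesis using F1[of x] by (simp add: supp_sum_def)
  qed
  have FgCc: "(\<lambda>x. of_real (F U x) * g x) \<in> Cc" if "U \<in> \<C>" for U
    by (rule mem_CcI(1)[OF _ Cc_compact_fsupport[OF g]])
       (use F[OF that] Cc_continuous[OF g] in \<open>auto intro!: continuous_intros simp: not_in_fsupport\<close>)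
  have "\<mu> (\<lambda>x. of_real (F U x) * g x) = 0" if U: "U \<in> \<C>" for U
  proof (cases "U = - fsupport g")
    case True
    then have "(\<lambda>x. of_real (F U x) * g x) = (\<lambda>x. 0)"
      using F0[OF U] by (auto simp: fun_eq_iff) (metis not_in_fsupport)
    then show ?thesis
      using linear_functional_zero[OF lin Cc_zero] by simp
  next
    case False
    then have "U \<in> \<U>" using U \<D>(1) by (auto simp: \<C>_def)
    then have van: "\<mu> f = 0" if "f \<in> Cc" "fsupport f \<subseteq> U" for f
      using that by (auto simp: \<U>_def)
    show ?thesis
    proof (rule radon_measure_vanishes_of_smaller_support[OF assms(1) FgCc[OF U]])
      fix h assume h: "h \<in> Cc" "fsupport h \<subseteq> {x. of_real (F U x) * g x \<noteq> 0}"
      then have "fsupport h \<subseteq> U" using F0[OF U] by fastforce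
      then show "\<mu> h = 0" by (rule van[OF h(1)])
    qed
  qed
  moreover have "g = (\<lambda>x. \<Sum>U\<in>\<C>. of_real (F U x) * g x)"
    by (simp add: sum1 sum_distrib_right[symmetric] of_real_sum[symmetric] del: of_real_sum)
  moreover have "\<mu> (\<lambda>x. \<Sum>U\<in>\<C>. of_real (F U x) * g x) = (\<Sum>U\<in>\<C>. \<mu> (\<lambda>x. of_real (F U x) * g x))"
    using linear_functional_Cc_sum[OF lin finC, of "\<lambda>U x. of_real (F U x) * g x"] FgCc by blast
  ultimately show ?thesis by simp
qed

text \<open>
  The analogue fails for distributions of positive order, such as the derivative of a point mass.
  For a measure, vanishing on the support suffices because \<open>\<mu>\<close> is continuous in the supremum norm on
  functions supported in a fixed compact set. Consequently \<open>\<mu>\<close> is a multiple of a point mass near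
  every isolated point of its support.
\<close>

lemma radon_measure_determined_by_support:
  fixes \<mu> :: "('a::metric_space \<Rightarrow> complex) \<Rightarrow> complex"
  assumes "radon_measure \<mu>" "f \<in> Cc" "\<And>x. x \<in> measure_support \<mu> \<Longrightarrow> f x = 0"
  shows "\<mu> f = 0"
proof (rule radon_measure_vanishes_of_smaller_support[OF assms(1,2)])
  fix g assume "g \<in> Cc" "fsupport g \<subseteq> {x. f x \<noteq> 0}"
  then show "\<mu> g = 0"
    using assms(3) by (intro radon_measure_vanishes_off_support[OF assms(1)]) auto
qed

text \<open>
  For a competitor \<open>f\<close>, the function \<open>f - f x * \<phi>\<close> vanishes on the support of \<open>\<mu>\<close>, so that
  \<open>\<mu> f = f x * \<mu> \<phi>\<close>. A single test function, which may be chosen smooth, thus controls the mass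
  of the point \<open>x\<close>.
\<close>

lemma mass_near_isolated_point:
  fixes \<mu> :: "('a::metric_space \<Rightarrow> complex) \<Rightarrow> complex"
  assumes \<mu>: "radon_measure \<mu>" and iso: "U \<inter> measure_support \<mu> \<subseteq> {x}"
    and \<phi>: "\<phi> \<in> Cc" "\<phi> x = 1" "\<And>y. y \<notin> U \<Longrightarrow> \<phi> y = 0"
  shows "total_variation_open \<mu> U \<le> ennreal (norm (\<mu> \<phi>))"
  unfolding total_variation_open_def
proof (rule SUP_least, elim CollectE conjE, rule ennreal_leI)
  fix f assume f: "f \<in> Cc" "fsupport f \<subseteq> U" "\<forall>y. norm (f y) \<le> 1"
  have lin: "linear_functional_on Cc \<mu>"
    using \<mu> by (simp add: radon_measure_def)
  have "(\<lambda>y. f y - f x * \<phi> y) = (\<lambda>y. f y + - f x * \<phi> y)" by simp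
  then have Cc: "(\<lambda>y. f y - f x * \<phi> y) \<in> Cc"
    using Cc_add[OF f(1) Cc_scale[OF \<phi>(1)]] by metis
  have "f y - f x * \<phi> y = 0" if "y \<in> measure_support \<mu>" for y
  proof (cases "y \<in> U")
    case True
    then show ?thesis using iso that \<phi>(2) by auto
  next
    case False
    then show ?thesis using f(2) \<phi>(3) not_in_fsupport[of y f] by auto
  qed
  then have "\<mu> (\<lambda>y. f y - f x * \<phi> y) = 0"
    by (rule radon_measure_determined_by_support[OF \<mu> Cc])
  then have "\<mu> f = f x * \<mu> \<phi>"
    using linear_functional_Cc_diff[OF lin f(1) Cc_scale[OF \<phi>(1)]]
      linear_functional_scale[OF lin \<phi>(1)] by simp
  then show "norm (\<mu> f) \<le> norm (\<mu> \<phi>)"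
    using f(3) by (simp add: norm_mult mult_left_le_one_le)
qed

section \<open>A smooth bump function on the line\<close>

text \<open>
  For \<open>p = 1\<close> this is the classical smooth function that vanishes exactly on the nonpositive reals. The
  polynomial factor is there to make the family closed under differentiation.
\<close>

definition exp_tail :: "real poly \<Rightarrow> real \<Rightarrow> real" where
  "exp_tail p t = (if t > 0 then poly p (1 / t) * exp (- (1 / t)) else 0)"

lemma poly_exp_minus_tendsto_0: "((\<lambda>u. poly p u * exp (- u)) \<longlongrightarrow> (0::real)) at_top"
proof -
  have "((\<lambda>u. \<Sum>i\<le>degree p. coeff p i * (u ^ i / exp u)) \<longlongrightarrow> (\<Sum>i\<le>degree p. coeff p i * 0)) at_top"
    by (intro tendsto_intros tendsto_power_div_exp_0)
  moreover have "(\<lambda>u. \<Sum>i\<le>degree p. coeff p i * (u ^ i / exp u)) = (\<lambda>u. poly p u * exp (- u))"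
    by (simp add: fun_eq_iff poly_altdef exp_minus sum_distrib_right divide_inverse mult.assoc)
  ultimately show ?thesis by simp
qed

lemma exp_tail_tendsto_0: "(exp_tail p \<longlongrightarrow> 0) (at 0)"
  unfolding filterlim_at_split
proof
  show "(exp_tail p \<longlongrightarrow> 0) (at_left 0)"
    by (rule tendsto_eventually) (auto simp: exp_tail_def eventually_at_filter)
  have "((\<lambda>t. poly p (inverse t) * exp (- inverse t)) \<longlongrightarrow> 0) (at_right 0)"
    by (rule filterlim_compose[OF poly_exp_minus_tendsto_0 filterlim_inverse_at_top_right])
  then show "(exp_tail p \<longlongrightarrow> 0) (at_right 0)"
    by (rule Lim_transform_eventually)
       (auto simp: exp_tail_def eventually_at_filter inverse_eq_divide)
qed

text \<open>
  Away from 0 this is the product rule. At 0 the difference quotient of the function for \<open>p\<close> is again a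
  function of the family, the one for \<open>[:0, 1:] * p\<close>, which tends to 0.
\<close>

lemma exp_tail_has_derivative:
  "(exp_tail p has_field_derivative exp_tail ([:0, 0, 1:] * (p - pderiv p)) t) (at t)"
proof -
  consider "t > 0" | "t < 0" | "t = 0" by linarith
  then show ?thesis
  proof cases
    case 1
    have "((\<lambda>t. poly p (1 / t) * exp (- (1 / t))) has_field_derivative
        exp_tail ([:0, 0, 1:] * (p - pderiv p)) t) (at t)"
      using 1 by (auto intro!: derivative_eq_intros DERIV_chain2[OF poly_DERIV]
          simp: exp_tail_def field_simps power2_eq_square)
    then show ?thesis
      by (rule has_field_derivative_transform_within_open[of _ _ _ "{0<..}"])
         (use 1 in \<open>auto simp: exp_tail_def\<close>)
  next
    case 2
    have "((\<lambda>t. 0) has_field_derivative exp_tail ([:0, 0, 1:] * (p - pderiv p)) t) (at t)"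
      using 2 by (simp add: exp_tail_def)
    then show ?thesis
      by (rule has_field_derivative_transform_within_open[of _ _ _ "{..<0}"])
         (use 2 in \<open>auto simp: exp_tail_def\<close>)
  next
    case 3
    have "((\<lambda>h. exp_tail p h / h) \<longlongrightarrow> 0) (at 0)"
      by (rule Lim_transform_eventually[OF exp_tail_tendsto_0[of "[:0, 1:] * p"]])
         (auto simp: exp_tail_def eventually_at_filter)
    then show ?thesis
      using 3 by (simp add: DERIV_def exp_tail_def)
  qed
qed

text \<open>
  Sums of products of two such functions, one for each end of the interval from \<open>- s\<close> to \<open>s\<close>. The class
  is closed under differentiation, which gives all derivatives of a member, and their vanishing outside
  the interval, by induction and without a formula for them.
\<close>

inductive exp_tail_span :: "real \<Rightarrow> (real \<Rightarrow> real) \<Rightarrow> bool" for s where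
  base: "exp_tail_span s (\<lambda>t. c * exp_tail p (s + t) * exp_tail q (s - t))"
| add: "exp_tail_span s f \<Longrightarrow> exp_tail_span s g \<Longrightarrow> exp_tail_span s (\<lambda>t. f t + g t)"

lemma exp_tail_span_vanishes: "exp_tail_span s f \<Longrightarrow> \<bar>t\<bar> \<ge> s \<Longrightarrow> f t = 0"
  by (induction rule: exp_tail_span.induct) (auto simp: exp_tail_def abs_if split: if_splits)

lemma exp_tail_span_derivative:
  assumes "exp_tail_span s f"
  shows "\<exists>f'. exp_tail_span s f' \<and> (\<forall>t. (f has_field_derivative f' t) (at t))"
  using assms
proof induction
  case (base c p q)
  let ?D = "\<lambda>p. [:0, 0, 1:] * (p - pderiv p)"
  let ?f = "\<lambda>t. c * exp_tail (?D p) (s + t) * exp_tail q (s - t)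
              + (- c) * exp_tail p (s + t) * exp_tail (?D q) (s - t)"
  have "exp_tail_span s ?f" by (intro exp_tail_span.intros)
  moreover have "((\<lambda>t. c * exp_tail p (s + t) * exp_tail q (s - t)) has_field_derivative ?f t) (at t)" for t
    by (rule derivative_eq_intros DERIV_chain2[OF exp_tail_has_derivative] refl | simp)+
  ultimately show ?case by (intro exI[of _ ?f] conjI allI)
next
  case (add f g)
  then obtain f' g' where
    "exp_tail_span s f'" "\<forall>t. (f has_field_derivative f' t) (at t)"
    "exp_tail_span s g'" "\<forall>t. (g has_field_derivative g' t) (at t)" by blast
  then show ?case
    by (intro exI[of _ "\<lambda>t. f' t + g' t"] conjI allI) (auto intro: exp_tail_span.add DERIV_add)
qed

lemma smooth_bump_real:
  assumes "s > 0"
  obtains G :: "nat \<Rightarrow> real \<Rightarrow> real" where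
    "G 0 0 = 1"
    "\<And>n t. (G n has_field_derivative G (Suc n) t) (at t)"
    "\<And>n t. \<bar>t\<bar> \<ge> s \<Longrightarrow> G n t = 0"
proof -
  define c where "c = inverse (exp_tail 1 s * exp_tail 1 s)"
  define b where "b = (\<lambda>t. c * exp_tail 1 (s + t) * exp_tail 1 (s - t))"
  define G where "G = (\<lambda>n. (deriv ^^ n) b)"
  have "exp_tail 1 s \<noteq> 0"
    using assms by (simp add: exp_tail_def)
  then have "b 0 = 1"
    by (simp add: b_def c_def field_simps)
  have "exp_tail_span s (G n)" for n
  proof (induction n)
    case 0
    then show ?case by (simp add: G_def b_def exp_tail_span.base)
  next
    case (Suc n)
    then obtain f' where f': "exp_tail_span s f'" "\<And>t. (G n has_field_derivative f' t) (at t)"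
      using exp_tail_span_derivative by meson
    then have "G (Suc n) = f'"
      by (auto simp: G_def fun_eq_iff intro: DERIV_imp_deriv)
    then show ?case using f' by simp
  qed
  note span = this
  have "(G n has_field_derivative G (Suc n) t) (at t)" for n t
  proof -
    obtain f' where "\<forall>t. (G n has_field_derivative f' t) (at t)"
      using exp_tail_span_derivative[OF span[of n]] by blast
    then show ?thesis
      using DERIV_imp_deriv[of "G n" "f' t" t] by (simp add: G_def)
  qed
  then show ?thesis
    using \<open>b 0 = 1\<close> exp_tail_span_vanishes[OF span] by (intro that[of G]) (auto simp: G_def)
qed

section \<open>Products of one-dimensional bumps\<close>

text \<open>
  When \<open>G k\<close> is the \<open>k\<close>-th derivative of a function \<open>b\<close> on the line, this is the partial derivative
  of order \<open>n\<close> of the product of the functions \<open>b (y $ i)\<close>, translated to \<open>x\<close>. Products of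
  one-dimensional bumps are used in place of radial ones because all their partial derivatives have this
  closed form.
\<close>

definition tensor_bump ::
    "(nat \<Rightarrow> real \<Rightarrow> real) \<Rightarrow> real^'d \<Rightarrow> ('d \<Rightarrow> nat) \<Rightarrow> real^'d::finite \<Rightarrow> complex" where
  "tensor_bump G x n y = of_real (\<Prod>i\<in>UNIV. G (n i) (y $ i - x $ i))"

lemma tensor_bump_has_derivative:
  assumes "\<And>n t. (G n has_field_derivative G (Suc n) t) (at t)"
  shows "(tensor_bump G x n has_derivative
     (\<lambda>h. of_real (\<Sum>i\<in>UNIV. G (Suc (n i)) (y $ i - x $ i) * h $ i *
        (\<Prod>j\<in>UNIV - {i}. G (n j) (y $ j - x $ j))))) (at y)"
proof -
  have "((\<lambda>y. G (n i) (y $ i - x $ i)) has_derivative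
      (\<lambda>h. G (Suc (n i)) (y $ i - x $ i) * h $ i)) (at y)" for i
  proof -
    have "((\<lambda>y. y $ i - x $ i) has_derivative (\<lambda>h. h $ i)) (at y)"
      by (auto intro!: derivative_eq_intros bounded_linear_imp_has_derivative bounded_linear_vec_nth)
    from has_derivative_compose[OF this, of "G (n i)"] show ?thesis
      using assms[of "n i" "y $ i - x $ i"] unfolding has_field_derivative_def by simp
  qed
  then show ?thesis
    unfolding tensor_bump_def by (intro has_derivative_of_real has_derivative_prod) auto
qed

lemma partial_deriv_tensor_bump:
  assumes "\<And>n t. (G n has_field_derivative G (Suc n) t) (at t)"
  shows "partial_deriv i (tensor_bump G x n) = tensor_bump G x (n(i := Suc (n i)))"
proof
  fix y
  have "(\<Sum>k\<in>UNIV. G (Suc (n k)) (y $ k - x $ k) * axis i 1 $ k *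
        (\<Prod>j\<in>UNIV - {k}. G (n j) (y $ j - x $ j)))
      = (\<Sum>k\<in>UNIV. if k = i then G (Suc (n i)) (y $ i - x $ i) *
        (\<Prod>j\<in>UNIV - {i}. G (n j) (y $ j - x $ j)) else 0)"
    by (intro sum.cong) (auto simp: axis_def)
  also have "\<dots> = G (Suc (n i)) (y $ i - x $ i) * (\<Prod>j\<in>UNIV - {i}. G (n j) (y $ j - x $ j))"
    by simp
  also have "\<dots> = (\<Prod>j\<in>UNIV. G ((n(i := Suc (n i))) j) (y $ j - x $ j))"
    by (subst prod.remove[of UNIV i]) auto
  finally show "partial_deriv i (tensor_bump G x n) y = tensor_bump G x (n(i := Suc (n i))) y"
    unfolding partial_deriv_def
    using frechet_derivative_at[OF tensor_bump_has_derivative[where G=G, OF assms, of x n y], symmetric]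
    by (simp add: tensor_bump_def del: of_real_sum of_real_prod of_real_mult)
qed

lemma iter_partial_tensor_bump:
  assumes "\<And>n t. (G n has_field_derivative G (Suc n) t) (at t)"
  shows "iter_partial is (tensor_bump G x (\<lambda>i. 0)) = tensor_bump G x (count_list is)"
proof (induction "is")
  case (Cons i js)
  have "(count_list js)(i := Suc (count_list js i)) = count_list (i # js)"
    by (auto simp: fun_eq_iff)
  moreover have "iter_partial (i # js) (tensor_bump G x (\<lambda>i. 0))
      = tensor_bump G x ((count_list js)(i := Suc (count_list js i)))"
    by (simp add: Cons partial_deriv_tensor_bump[where G=G, OF assms])
  ultimately show ?case by (simp only:)
qed simp

lemma smooth_tensor_bump:
  assumes "\<And>n t. (G n has_field_derivative G (Suc n) t) (at t)"
  shows "smooth (tensor_bump G x (\<lambda>i. 0))"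
  unfolding smooth_def iter_partial_tensor_bump[where G=G, OF assms]
  using tensor_bump_has_derivative[where G=G, OF assms] differentiable_def by blast

lemma tensor_bump_eq_0:
  assumes "\<And>n t. \<bar>t\<bar> \<ge> s \<Longrightarrow> G n t = 0" "\<bar>y $ i - x $ i\<bar> \<ge> s"
  shows "tensor_bump G x n y = 0"
  using assms(1)[OF assms(2)] by (auto simp: tensor_bump_def intro!: prod_zero)

lemma tensor_bump_Cc:
  assumes "\<And>n t. (G n has_field_derivative G (Suc n) t) (at t)"
    and "\<And>n t. \<bar>t\<bar> \<ge> s \<Longrightarrow> G n t = 0"
  shows "tensor_bump G x (\<lambda>i. 0) \<in> Cc"
proof (rule mem_CcI(1))
  show "continuous_on UNIV (tensor_bump G x (\<lambda>i. 0))"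
    using tensor_bump_has_derivative[where G=G, OF assms(1)]
    by (meson has_derivative_continuous continuous_at_imp_continuous_on)
  show "compact (cbox (\<chi> i. x $ i - s) (\<chi> i. x $ i + s))" by simp
  fix y assume "y \<notin> cbox (\<chi> i. x $ i - s) (\<chi> i. x $ i + s)"
  then obtain i where "\<not> (x $ i - s \<le> y $ i \<and> y $ i \<le> x $ i + s)"
    by (auto simp: mem_box_cart)
  then have "\<bar>y $ i - x $ i\<bar> \<ge> s" by linarith
  then show "tensor_bump G x (\<lambda>i. 0) y = 0"
    by (rule tensor_bump_eq_0[rotated]) (use assms in auto)
qed

text \<open>
  On the support of the translate, every coordinate of \<open>y\<close> is within distance 1 of the corresponding coordinate of
  \<open>x\<close>, so the growth of the monomial in \<open>y\<close> is paid for by a power of \<open>1 + (x $ i)\<^sup>2\<close> in each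
  coordinate separately.
\<close>

lemma monomial_tensor_bump_bound:
  fixes G :: "nat \<Rightarrow> real \<Rightarrow> real" and \<alpha> n :: "'d::finite \<Rightarrow> nat"
  assumes deriv: "\<And>n t. (G n has_field_derivative G (Suc n) t) (at t)"
    and van: "\<And>n t. \<bar>t\<bar> \<ge> 1 \<Longrightarrow> G n t = 0"
    and N: "\<And>i. \<alpha> i \<le> N"
  shows "\<exists>C>0. \<forall>x y. norm (monomial_fun \<alpha> y *\<^sub>R tensor_bump G x n y)
    \<le> C * (\<Prod>i\<in>UNIV. 1 + (x $ i)\<^sup>2) ^ N"
proof -
  have "\<exists>B>0. \<forall>t. \<bar>G k t\<bar> \<le> B" for k
  proof -
    have "continuous_on {-1..1} (G k)"
      using deriv by (meson DERIV_isCont continuous_at_imp_continuous_on)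
    then have "bounded (G k ` {-1..1})"
      by (intro compact_imp_bounded compact_continuous_image) auto
    then obtain B where B: "B > 0" "\<forall>z\<in>G k ` {-1..1}. norm z \<le> B"
      by (auto simp: bounded_pos)
    have "\<bar>G k t\<bar> \<le> B" for t
      using B van[of t k] by (cases "\<bar>t\<bar> \<ge> 1") (auto simp: abs_if split: if_splits)
    then show ?thesis using B by blast
  qed
  then obtain B where B: "\<And>k. B k > 0" "\<And>k t. \<bar>G k t\<bar> \<le> B k" by metis
  show ?thesis
  proof (intro exI[of _ "\<Prod>i\<in>UNIV. 3 ^ N * B (n i)"] conjI allI)
    fix x y :: "real^'d"
    have "\<bar>(y $ i) ^ \<alpha> i * G (n i) (y $ i - x $ i)\<bar> \<le> 3 ^ N * B (n i) * (1 + (x $ i)\<^sup>2) ^ N" for i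
    proof (cases "\<bar>y $ i - x $ i\<bar> \<ge> 1")
      case True
      then show ?thesis using B(1)[of "n i"] by (simp add: van)
    next
      case False
      have "\<bar>x $ i\<bar> \<le> 1 + (x $ i)\<^sup>2"
        using zero_le_power2[of "\<bar>x $ i\<bar> - 1"] by (simp add: power2_eq_square algebra_simps)
      moreover have "\<bar>y $ i\<bar> \<le> \<bar>x $ i\<bar> + 1"
        using False by linarith
      moreover have "1 + b \<le> 3 * (1 + q)" if "a \<le> 1 + q" "b \<le> a + 1" "0 \<le> q" for a b q :: real
        using that by (simp add: algebra_simps)
      ultimately have "1 + \<bar>y $ i\<bar> \<le> 3 * (1 + (x $ i)\<^sup>2)"
        using zero_le_power2 by blast
      then have "(1 + \<bar>y $ i\<bar>) ^ N \<le> (3 * (1 + (x $ i)\<^sup>2)) ^ N"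
        by (intro power_mono) auto
      then have *: "(1 + \<bar>y $ i\<bar>) ^ N \<le> 3 ^ N * (1 + (x $ i)\<^sup>2) ^ N"
        by (simp only: power_mult_distrib)
      have "\<bar>y $ i\<bar> ^ \<alpha> i \<le> (1 + \<bar>y $ i\<bar>) ^ \<alpha> i" by (intro power_mono) auto
      also have "\<dots> \<le> (1 + \<bar>y $ i\<bar>) ^ N" by (intro power_increasing N) auto
      also note *
      finally have "\<bar>y $ i\<bar> ^ \<alpha> i * \<bar>G (n i) (y $ i - x $ i)\<bar> \<le> 3 ^ N * (1 + (x $ i)\<^sup>2) ^ N * B (n i)"
        by (intro mult_mono B) auto
      then show ?thesis by (simp add: abs_mult power_abs mult_ac)
    qed
    then have "(\<Prod>i\<in>UNIV. \<bar>(y $ i) ^ \<alpha> i * G (n i) (y $ i - x $ i)\<bar>)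
        \<le> (\<Prod>i\<in>UNIV. 3 ^ N * B (n i) * (1 + (x $ i)\<^sup>2) ^ N)"
      by (intro prod_mono) auto
    also have "\<dots> = (\<Prod>i\<in>UNIV. 3 ^ N * B (n i)) * (\<Prod>i\<in>UNIV. 1 + (x $ i)\<^sup>2) ^ N"
      by (simp add: prod.distrib prod_power_distrib)
    also have "(\<Prod>i\<in>UNIV. \<bar>(y $ i) ^ \<alpha> i * G (n i) (y $ i - x $ i)\<bar>)
        = norm (monomial_fun \<alpha> y *\<^sub>R tensor_bump G x n y)"
      by (simp add: monomial_fun_def tensor_bump_def abs_mult prod.distrib abs_prod
          del: of_real_prod)
    finally show "norm (monomial_fun \<alpha> y *\<^sub>R tensor_bump G x n y)
        \<le> (\<Prod>i\<in>UNIV. 3 ^ N * B (n i)) * (\<Prod>i\<in>UNIV. 1 + (x $ i)\<^sup>2) ^ N" .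
  qed (use B in \<open>auto intro!: prod_pos\<close>)
qed

section \<open>Seminorm bounds for tempered distributions\<close>

lemma iter_partial_diff:
  assumes "smooth f" "smooth g"
  shows "iter_partial is (\<lambda>x. f x - g x) = (\<lambda>x. iter_partial is f x - iter_partial is g x)"
proof (induction "is")
  case (Cons i js)
  have "(iter_partial js f has_derivative frechet_derivative (iter_partial js f) (at x)) (at x)"
       "(iter_partial js g has_derivative frechet_derivative (iter_partial js g) (at x)) (at x)" for x
    using assms by (simp_all add: smooth_def frechet_derivative_works[symmetric])
  from frechet_derivative_at[OF has_derivative_diff[OF this], symmetric] show ?case
    by (simp add: partial_deriv_def Cons.IH fun_eq_iff)
qed simp

lemma iter_partial_scale:
  assumes "smooth f"
  shows "iter_partial is (\<lambda>x. c * f x) = (\<lambda>x. c * iter_partial is f x)"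
proof (induction "is")
  case (Cons i js)
  have "(iter_partial js f has_derivative frechet_derivative (iter_partial js f) (at x)) (at x)" for x
    using assms by (simp add: smooth_def frechet_derivative_works[symmetric])
  from frechet_derivative_at[OF has_derivative_mult_right[OF this], symmetric] show ?case
    by (simp add: partial_deriv_def Cons.IH fun_eq_iff)
qed simp

lemma schwartz_scale:
  assumes "f \<in> schwartz"
  shows "(\<lambda>x. c * f x) \<in> schwartz"
proof -
  have sm: "smooth f"
    and bd: "\<And>\<alpha> is. bounded (range (\<lambda>x. monomial_fun \<alpha> x *\<^sub>R iter_partial is f x))"
    using assms by (auto simp: schwartz_def)
  have "smooth (\<lambda>x. c * f x)"
    using sm by (auto simp: smooth_def iter_partial_scale[OF sm] intro!: derivative_intros)
  moreover have "bounded (range (\<lambda>x. monomial_fun \<alpha> x *\<^sub>R iter_partial is (\<lambda>x. c * f x) x))" for \<alpha> "is"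
  proof -
    have "(\<lambda>x. monomial_fun \<alpha> x *\<^sub>R iter_partial is (\<lambda>x. c * f x) x)
        = (\<lambda>x. c * (monomial_fun \<alpha> x *\<^sub>R iter_partial is f x))"
      by (simp add: iter_partial_scale[OF sm] fun_eq_iff)
    moreover have "bounded ((*) c ` range (\<lambda>x. monomial_fun \<alpha> x *\<^sub>R iter_partial is f x))"
      by (intro bounded_linear_image bd bounded_linear_mult_right)
    ultimately show ?thesis by (simp only: image_image)
  qed
  ultimately show ?thesis by (simp add: schwartz_def)
qed

lemma schwartz_seminorm_upper:
  assumes "f \<in> schwartz"
  shows "norm (monomial_fun \<alpha> x *\<^sub>R iter_partial is f x) \<le> schwartz_seminorm \<alpha> is f"
proof -
  have "bounded (range (\<lambda>x. monomial_fun \<alpha> x *\<^sub>R iter_partial is f x))"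
    using assms by (auto simp: schwartz_def)
  then have "bdd_above (range (\<lambda>x. norm (monomial_fun \<alpha> x *\<^sub>R iter_partial is f x)))"
    by (auto simp: bounded_iff bdd_above_def)
  then show ?thesis
    unfolding schwartz_seminorm_def by (rule cSUP_upper[rotated]) simp
qed

lemma schwartz_seminorm_least:
  assumes "\<And>x. norm (monomial_fun \<alpha> x *\<^sub>R iter_partial is f x) \<le> B"
  shows "schwartz_seminorm \<alpha> is f \<le> B"
  unfolding schwartz_seminorm_def by (rule cSUP_least) (use assms in auto)

lemma schwartz_diff:
  assumes "f \<in> schwartz" "g \<in> schwartz"
  shows "(\<lambda>x. f x - g x) \<in> schwartz"
proof -
  have sm: "smooth f" "smooth g"
    using assms by (auto simp: schwartz_def)
  have "smooth (\<lambda>x. f x - g x)"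
    using sm by (auto simp: smooth_def iter_partial_diff[OF sm] intro!: derivative_intros)
  moreover have "bounded (range (\<lambda>x. monomial_fun \<alpha> x *\<^sub>R iter_partial is (\<lambda>x. f x - g x) x))" for \<alpha> "is"
  proof -
    have "norm (monomial_fun \<alpha> x *\<^sub>R iter_partial is (\<lambda>x. f x - g x) x)
        \<le> schwartz_seminorm \<alpha> is f + schwartz_seminorm \<alpha> is g" for x
      unfolding iter_partial_diff[OF sm] scaleR_diff_right
      by (rule order_trans[OF norm_triangle_ineq4 add_mono[OF schwartz_seminorm_upper[OF assms(1)] schwartz_seminorm_upper[OF assms(2)]]])
    then show ?thesis by (auto simp: bounded_iff)
  qed
  ultimately show ?thesis by (simp add: schwartz_def)
qed

lemma schwartz_seminorm_triangle:
  assumes f: "f \<in> schwartz" and g: "g \<in> schwartz" and h: "h \<in> schwartz"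
  shows "schwartz_seminorm \<alpha> is (\<lambda>x. g x - h x)
      \<le> schwartz_seminorm \<alpha> is (\<lambda>x. g x - f x) + schwartz_seminorm \<alpha> is (\<lambda>x. f x - h x)"
proof (rule schwartz_seminorm_least)
  fix x
  have sm: "smooth f" "smooth g" "smooth h"
    using assms by (auto simp: schwartz_def)
  have "monomial_fun \<alpha> x *\<^sub>R iter_partial is (\<lambda>x. g x - h x) x
      = monomial_fun \<alpha> x *\<^sub>R iter_partial is (\<lambda>x. g x - f x) x
      + monomial_fun \<alpha> x *\<^sub>R iter_partial is (\<lambda>x. f x - h x) x"
    using sm by (simp add: iter_partial_diff algebra_simps)
  also have "norm \<dots> \<le> schwartz_seminorm \<alpha> is (\<lambda>x. g x - f x) + schwartz_seminorm \<alpha> is (\<lambda>x. f x - h x)"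
    by (intro norm_triangle_mono schwartz_seminorm_upper schwartz_diff assms)
  finally show "norm (monomial_fun \<alpha> x *\<^sub>R iter_partial is (\<lambda>x. g x - h x) x)
      \<le> schwartz_seminorm \<alpha> is (\<lambda>x. g x - f x) + schwartz_seminorm \<alpha> is (\<lambda>x. f x - h x)" .
qed

text \<open>
  The subbasic sets are balls around arbitrary centres; by the triangle inequality each contains a ball of
  the same seminorm around each of its points.
\<close>

lemma schwartz_topology_nbhd:
  assumes "openin schwartz_topology W" "f \<in> W"
  shows "\<exists>J e. finite J \<and> e > 0 \<and>
    (\<forall>g\<in>schwartz. (\<forall>(\<alpha>, is)\<in>J. schwartz_seminorm \<alpha> is (\<lambda>x. g x - f x) < e) \<longrightarrow> g \<in> W)"
proof -
  let ?S = "{{g \<in> schwartz. schwartz_seminorm \<alpha> is (\<lambda>x. g x - f x) < e} | f \<alpha> is e.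
        f \<in> schwartz \<and> e > 0} :: (real^'a \<Rightarrow> complex) set set"
  have "generate_topology_on ?S W"
    using assms(1) unfolding schwartz_topology_def by (rule openin_topology_generated_by)
  then show ?thesis
    using assms(2)
  proof induction
    case Empty
    then show ?case by simp
  next
    case (Int a b)
    obtain J d where J: "finite J" "d > 0"
      "\<forall>g\<in>schwartz. (\<forall>(\<alpha>, is)\<in>J. schwartz_seminorm \<alpha> is (\<lambda>x. g x - f x) < d) \<longrightarrow> g \<in> a"
      using Int by blast
    obtain K e where K: "finite K" "e > 0"
      "\<forall>g\<in>schwartz. (\<forall>(\<alpha>, is)\<in>K. schwartz_seminorm \<alpha> is (\<lambda>x. g x - f x) < e) \<longrightarrow> g \<in> b"
      using Int by blast
    show ?case
      by (rule exI[of _ "J \<union> K"], rule exI[of _ "min d e"]) (use J K in fastforce)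
  next
    case (UN K)
    then obtain k where "k \<in> K" "f \<in> k" by blast
    with UN.IH[OF this] show ?case by blast
  next
    case (Basis s)
    then obtain h \<alpha> "is" e where s: "h \<in> schwartz"
      "s = {g \<in> schwartz. schwartz_seminorm \<alpha> is (\<lambda>x. g x - h x) < e}" by blast
    with Basis have f: "f \<in> schwartz" "schwartz_seminorm \<alpha> is (\<lambda>x. f x - h x) < e" by auto
    let ?d = "e - schwartz_seminorm \<alpha> is (\<lambda>x. f x - h x)"
    have "g \<in> s" if "g \<in> schwartz" "schwartz_seminorm \<alpha> is (\<lambda>x. g x - f x) < ?d" for g
      using that s schwartz_seminorm_triangle[OF f(1) that(1) s(1), of \<alpha> "is"] by auto
    then show ?case
      by (intro exI[of _ "{(\<alpha>, is)}"] exI[of _ ?d]) (use f in auto)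
  qed
qed

text \<open>
  A continuous functional is bounded by 1 on a neighbourhood of 0, hence, by homogeneity, by
  finitely many seminorms. The bound \<open>B\<close> is a separate variable, so that no maximum over the possibly
  empty set \<open>J\<close> occurs.
\<close>

lemma tempered_distribution_bound:
  assumes "tempered_distribution T"
  obtains J C where "finite J" "C > 0"
    "\<And>f B. f \<in> schwartz \<Longrightarrow> B > 0 \<Longrightarrow> (\<And>\<alpha> is. (\<alpha>, is) \<in> J \<Longrightarrow> schwartz_seminorm \<alpha> is f \<le> B) \<Longrightarrow>
       norm (T f) \<le> C * B"
proof (cases "schwartz = ({} :: (real^'a \<Rightarrow> complex) set)")
  case True
  then show ?thesis by (intro that[of "{}" 1]) auto
next
  case False
  have lin: "linear_functional_on schwartz T"
    and cont: "continuous_map schwartz_topology euclidean T"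
    using assms by (auto simp: tempered_distribution_def)
  obtain f0 :: "real^'a \<Rightarrow> complex" where "f0 \<in> schwartz" using False by blast
  from schwartz_scale[OF this, of 0] have zero: "(\<lambda>x. 0) \<in> (schwartz :: (real^'a \<Rightarrow> complex) set)"
    by simp
  define W where "W = {f \<in> topspace schwartz_topology. T f \<in> ball 0 1}"
  have op: "openin schwartz_topology W"
    unfolding W_def using openin_continuous_map_preimage[OF cont, of "ball 0 1"] by simp
  \<comment> \<open>A subbasic set containing 0: it shows that 0 is a point of the topological space.\<close>
  define U :: "(real^'a \<Rightarrow> complex) set" where "U = {g \<in> schwartz. schwartz_seminorm (\<lambda>_. 0) [] (\<lambda>x. g x - 0) <
      \<bar>schwartz_seminorm (\<lambda>_. 0) [] (\<lambda>x :: real^'a. 0)\<bar> + 1}"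
  have "openin schwartz_topology U"
    unfolding schwartz_topology_def
    by (rule topology_generated_by_Basis, rule CollectI, intro exI conjI, rule U_def, rule zero) simp
  moreover have "(\<lambda>x. 0) \<in> U"
    using zero by (auto simp: U_def)
  ultimately have "(\<lambda>x. 0) \<in> topspace (schwartz_topology :: (real^'a \<Rightarrow> complex) topology)"
    using openin_subset by blast
  then have "(\<lambda>x. 0) \<in> W"
    using linear_functional_zero[OF lin zero] by (simp add: W_def)
  from schwartz_topology_nbhd[OF op this] obtain J e where J: "finite J" "e > 0"
    "\<And>g. g \<in> schwartz \<Longrightarrow> (\<forall>(\<alpha>, is)\<in>J. schwartz_seminorm \<alpha> is (\<lambda>x. g x - 0) < e) \<Longrightarrow> g \<in> W"
    by blast
  show ?thesis
  proof (rule that[of J "2 / e"])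
    fix f B assume f: "f \<in> schwartz" and B: "B > 0"
      and le: "\<And>\<alpha> is. (\<alpha>, is) \<in> J \<Longrightarrow> schwartz_seminorm \<alpha> is f \<le> B"
    define c where "c = e / (2 * B)"
    have c: "c > 0" using J B by (simp add: c_def)
    have "schwartz_seminorm \<alpha> is (\<lambda>x. of_real c * f x) < e" if "(\<alpha>, is) \<in> J" for \<alpha> "is"
    proof -
      have sm: "smooth f" using f by (simp add: schwartz_def)
      have "schwartz_seminorm \<alpha> is (\<lambda>x. of_real c * f x) \<le> c * B"
      proof (rule schwartz_seminorm_least)
        fix x
        have "norm (monomial_fun \<alpha> x *\<^sub>R iter_partial is (\<lambda>x. of_real c * f x) x)
            = c * norm (monomial_fun \<alpha> x *\<^sub>R iter_partial is f x)"
          using c by (simp add: iter_partial_scale[OF sm] norm_mult)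
        also have "\<dots> \<le> c * B"
          using schwartz_seminorm_upper[OF f, of \<alpha> x "is"] le[OF that] c by (intro mult_left_mono) auto
        finally show "norm (monomial_fun \<alpha> x *\<^sub>R iter_partial is (\<lambda>x. of_real c * f x) x) \<le> c * B" .
      qed
      also have "c * B = e / 2" using B by (simp add: c_def)
      finally show ?thesis using J(2) by simp
    qed
    then have "(\<lambda>x. of_real c * f x) \<in> W"
      by (intro J(3) schwartz_scale f) auto
    then have "norm (of_real c * T f) < 1"
      using linear_functional_scale[OF lin f, of "of_real c"] by (simp add: W_def)
    then have "c * norm (T f) < 1"
      using c by (simp add: norm_mult)
    then show "norm (T f) \<le> 2 / e * B"
      using J(2) B by (simp add: c_def field_simps)
  qed (use J in auto)
qed

text \<open>
  Temperedness bounds \<open>T\<close> by finitely many seminorms, and translating a fixed bump makes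
  each of them grow only polynomially in the centre.
\<close>

lemma tensor_bump_bounded_by_weight:
  fixes G :: "nat \<Rightarrow> real \<Rightarrow> real" and T :: "(real^'d::finite \<Rightarrow> complex) \<Rightarrow> complex"
  assumes T: "tempered_distribution T"
    and deriv: "\<And>n t. (G n has_field_derivative G (Suc n) t) (at t)"
    and van: "\<And>n t. \<bar>t\<bar> \<ge> 1 \<Longrightarrow> G n t = 0"
  obtains A N where "A \<ge> 0"
    "\<And>x. norm (T (tensor_bump G x (\<lambda>i. 0))) \<le> A * (\<Prod>i\<in>UNIV. 1 + (x $ i)\<^sup>2) ^ N"
proof -
  define q :: "real^'d \<Rightarrow> real" where "q = (\<lambda>x. \<Prod>i\<in>UNIV. 1 + (x $ i)\<^sup>2)"
  have q: "q x > 0" for x unfolding q_def by (intro prod_pos) (auto intro: add_pos_nonneg)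
  have bound: "\<exists>C>0. \<forall>x y. norm (monomial_fun \<alpha> y *\<^sub>R iter_partial is (tensor_bump G x (\<lambda>i. 0)) y) \<le> C * q x ^ N"
    if "\<And>i. \<alpha> i \<le> N" for \<alpha> "is" N
    unfolding iter_partial_tensor_bump[where G = G, OF deriv] q_def
    by (rule monomial_tensor_bump_bound[where G = G, OF deriv van that])
  have schwartz: "tensor_bump G x (\<lambda>i. 0) \<in> schwartz" for x :: "real^'d"
  proof -
    have "bounded (range (\<lambda>y. monomial_fun \<alpha> y *\<^sub>R iter_partial is (tensor_bump G x (\<lambda>i. 0)) y))" for \<alpha> "is"
      using bound[of \<alpha> "Max (range \<alpha>)" "is"] by (force simp: bounded_iff)
    then show ?thesis
      using smooth_tensor_bump[where G = G, OF deriv] by (simp add: schwartz_def)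
  qed
  obtain J C where J: "finite J" "C > 0"
    "\<And>f B. f \<in> schwartz \<Longrightarrow> B > 0 \<Longrightarrow> (\<And>\<alpha> is. (\<alpha>, is) \<in> J \<Longrightarrow> schwartz_seminorm \<alpha> is f \<le> B) \<Longrightarrow>
       norm (T f) \<le> C * B"
    using tempered_distribution_bound[OF T] by blast
  \<comment> \<open>The elements 0 here and 1 in the definition of \<open>E\<close> below cover the case of an empty \<open>J\<close>.\<close>
  define N where "N = Max (insert 0 (\<Union>(\<alpha>, is)\<in>J. range \<alpha>))"
  have N: "\<alpha> i \<le> N" if "(\<alpha>, is) \<in> J" for \<alpha> "is" i
    unfolding N_def using that J(1) by (intro Max_ge) auto
  have "\<forall>j\<in>J. \<exists>D>0. \<forall>x. schwartz_seminorm (fst j) (snd j) (tensor_bump G x (\<lambda>i. 0)) \<le> D * q x ^ N"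
  proof
    fix j assume "j \<in> J"
    then obtain D where "D > 0" "\<forall>x y. norm (monomial_fun (fst j) y *\<^sub>R
        iter_partial (snd j) (tensor_bump G x (\<lambda>i. 0)) y) \<le> D * q x ^ N"
      using bound[of "fst j" N "snd j"] N[of "fst j" "snd j"] by auto
    then show "\<exists>D>0. \<forall>x. schwartz_seminorm (fst j) (snd j) (tensor_bump G x (\<lambda>i. 0)) \<le> D * q x ^ N"
      by (blast intro: schwartz_seminorm_least)
  qed
  then obtain D where D: "\<And>j. j \<in> J \<Longrightarrow> D j > 0"
    "\<And>j x. j \<in> J \<Longrightarrow> schwartz_seminorm (fst j) (snd j) (tensor_bump G x (\<lambda>i. 0)) \<le> D j * q x ^ N"
    by metis
  define E where "E = 1 + (\<Sum>j\<in>J. D j)"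
  have E: "D j \<le> E" if "j \<in> J" for j
  proof -
    have "D j \<le> sum D J" using that J(1) D(1) by (intro member_le_sum) (auto intro: less_imp_le)
    then show ?thesis by (simp add: E_def)
  qed
  have "E > 0" unfolding E_def using D(1) by (intro add_pos_nonneg sum_nonneg) (auto intro: less_imp_le)
  show ?thesis
  proof (rule that[of "C * E" N])
    show "C * E \<ge> 0" using J(2) \<open>E > 0\<close> by simp
    fix x
    have "norm (T (tensor_bump G x (\<lambda>i. 0))) \<le> C * (E * q x ^ N)"
    proof (rule J(3)[OF schwartz])
      show "E * q x ^ N > 0" using \<open>E > 0\<close> q[of x] by simp
      fix \<alpha> "is" assume j: "(\<alpha>, is) \<in> J"
      have "schwartz_seminorm \<alpha> is (tensor_bump G x (\<lambda>i. 0)) \<le> D (\<alpha>, is) * q x ^ N"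
        using D(2)[OF j] by simp
      also have "\<dots> \<le> E * q x ^ N"
        using E[OF j] q[of x] by (intro mult_right_mono) auto
      finally show "schwartz_seminorm \<alpha> is (tensor_bump G x (\<lambda>i. 0)) \<le> E * q x ^ N" .
    qed
    then show "norm (T (tensor_bump G x (\<lambda>i. 0))) \<le> C * E * (\<Prod>i\<in>UNIV. 1 + (x $ i)\<^sup>2) ^ N"
      by (simp add: q_def mult.assoc)
  qed
qed

section \<open>Summation over uniformly discrete sets\<close>

lemma abs_summable_int_inverse_square:
  "Infinite_Set_Sum.abs_summable_on (\<lambda>k :: int. 1 / (1 + (of_int k)\<^sup>2) :: real) UNIV"
proof -
  have "summable (\<lambda>n. inverse (real n ^ 2))"
    by (rule inverse_power_summable) simp
  then have "summable (\<lambda>n. 1 / (1 + (real n)\<^sup>2))"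
    by (rule summable_comparison_test_ev[rotated])
       (auto simp: eventually_sequentially inverse_eq_divide intro!: exI[of _ 1] frac_le)
  then have nat: "Infinite_Set_Sum.abs_summable_on (\<lambda>n. 1 / (1 + (real n)\<^sup>2)) UNIV"
    by (simp add: abs_summable_on_nat_iff')
  have *: "Infinite_Set_Sum.abs_summable_on (\<lambda>k :: int. 1 / (1 + (of_int k)\<^sup>2) :: real) (g ` UNIV)"
    if "inj g" "\<And>n. \<bar>g n\<bar> = int n" for g
  proof -
    have "(of_int (g n) :: real)\<^sup>2 = (real n)\<^sup>2" for n
      by (metis that(2) of_int_abs of_int_of_nat_eq power2_abs)
    then show ?thesis
      using nat by (simp add: abs_summable_on_reindex_iff[OF that(1), symmetric])
  qed
  have "UNIV = range int \<union> range (\<lambda>n. - int n)"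
    by (auto simp: image_iff) (metis int_cases2)
  then show ?thesis
    using abs_summable_on_union[OF *[of int] *[of "\<lambda>n. - int n"]] by (simp add: inj_on_def)
qed

text \<open>
  A grid of cubes so small that no cube contains two points of \<open>\<Lambda>\<close> embeds \<open>\<Lambda>\<close> into the integer
  lattice and changes the weight only by a constant factor. Over the lattice the sum is a power of
  a convergent one-dimensional sum.
\<close>

lemma uniformly_discrete_summable:
  fixes \<Lambda> :: "(real^'d::finite) set"
  assumes "r > 0" and sep: "\<And>x y. x \<in> \<Lambda> \<Longrightarrow> y \<in> \<Lambda> \<Longrightarrow> x \<noteq> y \<Longrightarrow> dist x y \<ge> r"
  shows "countable \<Lambda>"
    and "Infinite_Set_Sum.abs_summable_on (\<lambda>x. \<Prod>i\<in>UNIV. 1 / (1 + (x $ i)\<^sup>2)) \<Lambda>"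
proof -
  \<comment> \<open>Points of one cube of side \<open>\<delta>\<close> are closer than \<open>r\<close>, since the norm is at most the sum of the coordinates.\<close>
  define \<delta> where "\<delta> = min 1 (r / (2 * real CARD('d)))"
  have \<delta>: "0 < \<delta>" "\<delta> \<le> 1" "real CARD('d) * \<delta> < r"
  proof -
    show "0 < \<delta>" "\<delta> \<le> 1" using assms(1) by (auto simp: \<delta>_def)
    have "real CARD('d) * \<delta> \<le> real CARD('d) * (r / (2 * real CARD('d)))"
      by (intro mult_left_mono) (auto simp: \<delta>_def)
    also have "\<dots> < r" using assms(1) by simp
    finally show "real CARD('d) * \<delta> < r" .
  qed
  define cell :: "real^'d \<Rightarrow> 'd \<Rightarrow> int" where "cell = (\<lambda>x i. \<lfloor>x $ i / \<delta>\<rfloor>)"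
  have cell: "of_int (cell x i) * \<delta> \<le> x $ i" "x $ i < (of_int (cell x i) + 1) * \<delta>" for x i
    using \<delta>(1) by (auto simp: cell_def pos_le_divide_eq[symmetric] pos_divide_less_eq[symmetric])
  have inj: "inj_on cell \<Lambda>"
  proof (rule inj_onI, rule ccontr)
    fix x y assume xy: "x \<in> \<Lambda>" "y \<in> \<Lambda>" "cell x = cell y" "x \<noteq> y"
    have "\<bar>(x - y) $ i\<bar> \<le> \<delta>" for i
      using cell[of x i] cell[of y i] xy(3) by (simp add: algebra_simps abs_le_iff)
    then have "(\<Sum>i\<in>UNIV. \<bar>(x - y) $ i\<bar>) \<le> real CARD('d) * \<delta>"
      using sum_mono[of UNIV "\<lambda>i. \<bar>(x - y) $ i\<bar>" "\<lambda>i. \<delta>"] by simp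
    then have "dist x y < r"
      using norm_le_l1_cart[of "x - y"] \<delta>(3) by (simp add: dist_norm)
    then show False using sep[OF xy(1,2,4)] by simp
  qed
  show "countable \<Lambda>"
    using inj by (rule countableI')
  let ?g = "\<lambda>k :: int. 1 / (1 + (of_int k)\<^sup>2) :: real"
  have "Infinite_Set_Sum.abs_summable_on (\<lambda>k. \<Prod>i\<in>(UNIV :: 'd set). ?g (k i)) (PiE UNIV (\<lambda>_. UNIV))"
    by (intro abs_summable_on_prod_PiE abs_summable_int_inverse_square) auto
  then have "Infinite_Set_Sum.abs_summable_on (\<lambda>k. \<Prod>i\<in>(UNIV :: 'd set). ?g (k i)) (cell ` \<Lambda>)"
    by (rule Infinite_Set_Sum.abs_summable_on_subset) auto
  then have "Infinite_Set_Sum.abs_summable_on (\<lambda>x. \<Prod>i\<in>UNIV. ?g (cell x i)) \<Lambda>"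
    by (subst (asm) Infinite_Set_Sum.abs_summable_on_reindex_iff[OF inj, symmetric])
  then have sm: "Infinite_Set_Sum.abs_summable_on (\<lambda>x. (\<Prod>i\<in>(UNIV::'d set). 3 / \<delta>\<^sup>2) * (\<Prod>i\<in>UNIV. ?g (cell x i))) \<Lambda>"
    by (intro Infinite_Set_Sum.abs_summable_on_cmult_right)
  show "Infinite_Set_Sum.abs_summable_on (\<lambda>x. \<Prod>i\<in>UNIV. 1 / (1 + (x $ i)\<^sup>2)) \<Lambda>"
  proof (rule Infinite_Set_Sum.abs_summable_on_comparison_test[OF sm])
    fix x :: "real^'d"
    have "1 / (1 + (x $ i)\<^sup>2) \<le> 3 / \<delta>\<^sup>2 * ?g (cell x i)" for i
    proof -
      define k :: real where "k = of_int (cell x i)"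
      have "\<bar>k * \<delta>\<bar> \<le> \<bar>x $ i\<bar> + 1"
        using cell[of x i] \<delta> by (simp add: k_def algebra_simps abs_le_iff) linarith
      then have "(k * \<delta>)\<^sup>2 \<le> (\<bar>x $ i\<bar> + 1)\<^sup>2"
        by (metis abs_ge_zero power2_abs power_mono)
      also have "\<dots> \<le> 2 + 2 * (x $ i)\<^sup>2"
        using zero_le_power2[of "\<bar>x $ i\<bar> - 1"] by (simp add: power2_eq_square algebra_simps)
      finally have "(k * \<delta>)\<^sup>2 \<le> 2 + 2 * (x $ i)\<^sup>2" .
      moreover have "\<delta>\<^sup>2 \<le> 1" using \<delta> by (simp add: power_le_one)
      moreover have "d + c \<le> 3 * (1 + q)" if "c \<le> 2 + 2 * q" "d \<le> 1" "0 \<le> q" for c d q :: real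
        using that by (simp add: algebra_simps)
      ultimately have "\<delta>\<^sup>2 + (k * \<delta>)\<^sup>2 \<le> 3 * (1 + (x $ i)\<^sup>2)"
        using zero_le_power2 by blast
      then have "\<delta>\<^sup>2 * (1 + k\<^sup>2) \<le> 3 * (1 + (x $ i)\<^sup>2)"
        by (simp add: power_mult_distrib algebra_simps)
      moreover have "0 < 1 + k\<^sup>2" "0 < 1 + (x $ i)\<^sup>2" "0 < \<delta>\<^sup>2"
        using \<delta>(1) by (auto intro: add_pos_nonneg)
      moreover have "1 / u \<le> 3 / d * (1 / v)" if "d * v \<le> 3 * u" "0 < v" "0 < u" "0 < d" for d u v :: real
        using that by (simp add: field_simps)
      ultimately show ?thesis
        unfolding k_def by blast
    qed
    then have "(\<Prod>i\<in>UNIV. 1 / (1 + (x $ i)\<^sup>2)) \<le> (\<Prod>i\<in>UNIV. 3 / \<delta>\<^sup>2 * ?g (cell x i))"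
      by (intro prod_mono) (auto intro!: divide_nonneg_nonneg)
    also have "\<dots> = (\<Prod>i\<in>(UNIV::'d set). 3 / \<delta>\<^sup>2) * (\<Prod>i\<in>UNIV. ?g (cell x i))"
      by (simp only: prod.distrib)
    finally have le: "(\<Prod>i\<in>UNIV. 1 / (1 + (x $ i)\<^sup>2)) \<le> \<dots>" .
    moreover have "0 \<le> (\<Prod>i\<in>UNIV. 1 / (1 + (x $ i)\<^sup>2))"
      by (intro prod_nonneg) auto
    ultimately show "norm (\<Prod>i\<in>UNIV. 1 / (1 + (x $ i)\<^sup>2))
        \<le> norm ((\<Prod>i\<in>(UNIV::'d set). 3 / \<delta>\<^sup>2) * (\<Prod>i\<in>UNIV. ?g (cell x i)))"
      by (simp only: real_norm_def)
  qed
qed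

section \<open>Polynomial weights\<close>

text \<open>
  Expanding the product gives the sum of the monomials with all exponents in \<open>{0, K}\<close>, each with
  coefficient 1, which describes the polynomial explicitly. The product of the factors
  \<open>(1 + (x $ i)\<^sup>2) ^ K\<close> would need binomial coefficients; by the next lemma, the one here with
  \<open>2 * K\<close> in place of \<open>K\<close> is at least as large up to a constant.
\<close>

lemma poly_eval_prod_one_plus_power:
  fixes K :: nat
  assumes "K > 0"
  obtains P :: "('d::finite \<Rightarrow>\<^sub>0 nat) \<Rightarrow>\<^sub>0 complex"
    where "\<And>x. poly_eval P x = of_real (\<Prod>i\<in>UNIV. 1 + (x $ i) ^ K)"
proof -
  define B where "B = PiE (UNIV :: 'd set) (\<lambda>_. {0, K})"
  have finB: "finite B" unfolding B_def by (intro finite_PiE) auto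
  define M where "M = (Abs_poly_mapping ` B :: ('d \<Rightarrow>\<^sub>0 nat) set)"
  have look: "Poly_Mapping.lookup (Abs_poly_mapping \<beta> :: 'd \<Rightarrow>\<^sub>0 nat) = \<beta>" for \<beta>
    by (rule Abs_poly_mapping_inverse) auto
  have inj: "inj_on (Abs_poly_mapping :: _ \<Rightarrow> ('d \<Rightarrow>\<^sub>0 nat)) B"
    by (rule inj_on_inverseI) (rule look)
  define P :: "('d \<Rightarrow>\<^sub>0 nat) \<Rightarrow>\<^sub>0 complex" where "P = Abs_poly_mapping (\<lambda>m. if m \<in> M then 1 else 0)"
  have "finite M" unfolding M_def using finB by simp
  then have lookP: "Poly_Mapping.lookup P = (\<lambda>m. if m \<in> M then 1 else 0)"
    unfolding P_def by simp
  then have keys: "Poly_Mapping.keys P = M"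
    by (auto simp: in_keys_iff split: if_splits)
  have "poly_eval P x = of_real (\<Prod>i\<in>UNIV. 1 + (x $ i) ^ K)" for x
  proof -
    have "poly_eval P x = (\<Sum>m\<in>M. of_real (monomial_fun (Poly_Mapping.lookup m) x))"
      unfolding poly_eval_def keys by (simp add: lookP)
    also have "\<dots> = (\<Sum>\<beta>\<in>B. of_real (monomial_fun \<beta> x))"
      unfolding M_def by (simp add: sum.reindex[OF inj] look)
    also have "\<dots> = of_real (\<Sum>\<beta>\<in>B. \<Prod>i\<in>UNIV. (x $ i) ^ \<beta> i)"
      by (simp add: monomial_fun_def)
    also have "(\<Sum>\<beta>\<in>B. \<Prod>i\<in>UNIV. (x $ i) ^ \<beta> i) = (\<Prod>i\<in>UNIV. \<Sum>k\<in>{0, K}. (x $ i) ^ k)"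
      unfolding B_def by (rule prod_sum_PiE[symmetric]) auto
    also have "\<dots> = (\<Prod>i\<in>UNIV. 1 + (x $ i) ^ K)"
      using assms by simp
    finally show ?thesis .
  qed
  then show ?thesis by (rule that)
qed

lemma one_plus_square_power_le: "(1 + t\<^sup>2) ^ K \<le> 2 ^ K * (1 + t ^ (2 * K))" for t :: real
proof -
  have "(1 + t\<^sup>2) ^ K \<le> (2 * max 1 (t\<^sup>2)) ^ K"
    by (intro power_mono) auto
  also have "\<dots> = 2 ^ K * max 1 (t\<^sup>2) ^ K"
    by (simp add: power_mult_distrib)
  also have "max 1 (t\<^sup>2) ^ K \<le> 1 + t ^ (2 * K)"
    by (cases "1 \<le> t\<^sup>2") (auto simp: max_def power_mult)
  finally show ?thesis by simp
qed

section \<open>Integration against the total variation\<close>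

text \<open>
  The measure of \<open>A\<close> is either the infimum over open supersets or the value 0 that
  \<open>measure_of\<close> assigns when its arguments do not form a measure space. The bound holds in both cases.
\<close>

lemma emeasure_total_variation_le:
  fixes \<mu> :: "('a::topological_space \<Rightarrow> complex) \<Rightarrow> complex"
  assumes "open U" "A \<subseteq> U"
  shows "emeasure (total_variation \<mu>) A \<le> total_variation_open \<mu> U"
  unfolding total_variation_def emeasure_measure_of_conv
  using assms by (auto intro: INF_lower)

lemma sets_total_variation [simp, measurable_cong]:
  fixes \<mu> :: "('a::topological_space \<Rightarrow> complex) \<Rightarrow> complex"
  shows "sets (total_variation \<mu>) = sets borel"
  unfolding total_variation_def by (metis sets.sigma_sets_eq sets_measure_of_conv space_borel top_greatest sets.space_closed)

lemma nn_integral_concentrated_on_countable: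
  assumes "countable \<Lambda>" "\<Lambda> \<in> sets M" "emeasure M (space M - \<Lambda>) = 0"
    and single: "\<And>x. x \<in> \<Lambda> \<Longrightarrow> {x} \<in> sets M"
  shows "(\<integral>\<^sup>+ x. f x \<partial>M) = (\<integral>\<^sup>+ x. f x * emeasure M {x} \<partial>count_space \<Lambda>)"
proof -
  have "AE x in M. x \<in> \<Lambda>"
    by (rule AE_I[of _ _ "space M - \<Lambda>"]) (use assms in auto)
  then have "(\<integral>\<^sup>+ x. f x \<partial>M) = (\<integral>\<^sup>+ x. (\<integral>\<^sup>+ y. f y * indicator {y} x \<partial>count_space \<Lambda>) \<partial>M)"
  proof (intro nn_integral_cong_AE, eventually_elim)
    case (elim x)
    have "(\<integral>\<^sup>+ y. f y * indicator {y} x \<partial>count_space \<Lambda>)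
        = (\<integral>\<^sup>+ y. f y * indicator {y} x \<partial>count_space {x})"
      by (rule nn_integral_count_space_eq) (use elim in \<open>auto simp: indicator_def\<close>)
    then show ?case by (simp add: nn_integral_count_space_finite)
  qed
  also have "\<dots> = (\<integral>\<^sup>+ y. (\<integral>\<^sup>+ x. f y * indicator {y} x \<partial>M) \<partial>count_space \<Lambda>)"
    by (rule nn_integral_count_space_nn_integral[OF assms(1)]) (use single in measurable)
  also have "\<dots> = (\<integral>\<^sup>+ y. f y * emeasure M {y} \<partial>count_space \<Lambda>)"
    by (rule nn_integral_cong) (use single in \<open>auto simp: nn_integral_cmult_indicator\<close>)
  finally show ?thesis .
qed

text \<open>
  The total variation lives on the countable support, so the integral is a sum over points. The
  polynomial outgrows the masses by one further factor \<open>1 + (x $ i)\<^sup>2\<close> in each coordinate, which leaves a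
  summable weight.
\<close>

lemma slowly_increasingI:
  fixes \<mu> :: "(real^'d::finite \<Rightarrow> complex) \<Rightarrow> complex"
  assumes \<mu>: "radon_measure \<mu>" and "r > 0"
    and sep: "\<And>x y. x \<in> measure_support \<mu> \<Longrightarrow> y \<in> measure_support \<mu> \<Longrightarrow> x \<noteq> y \<Longrightarrow> dist x y \<ge> r"
    and mass: "\<And>x. x \<in> measure_support \<mu> \<Longrightarrow>
      emeasure (total_variation \<mu>) {x} \<le> ennreal (A * (\<Prod>i\<in>UNIV. 1 + (x $ i)\<^sup>2) ^ N)"
    and "A \<ge> 0"
  shows "slowly_increasing \<mu>"
proof -
  define \<Lambda> where "\<Lambda> = measure_support \<mu>"
  define q :: "real^'d \<Rightarrow> real" where "q = (\<lambda>x. \<Prod>i\<in>UNIV. 1 + (x $ i)\<^sup>2)"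
  have q: "q x > 0" for x unfolding q_def by (intro prod_pos) (auto intro: add_pos_nonneg)
  define K where "K = Suc N"
  define c :: real where "c = (\<Prod>i\<in>(UNIV :: 'd set). 2 ^ K)"
  have c: "c > 0" unfolding c_def by (intro prod_pos) auto
  have "2 * K > 0" by (simp add: K_def)
  from poly_eval_prod_one_plus_power[OF this]
  obtain P :: "('d \<Rightarrow>\<^sub>0 nat) \<Rightarrow>\<^sub>0 complex"
    where P: "\<And>x. poly_eval P x = of_real (\<Prod>i\<in>UNIV. 1 + (x $ i) ^ (2 * K))" by blast
  have lower: "q x ^ K \<le> c * norm (poly_eval P x)" for x
  proof -
    have "q x ^ K \<le> (\<Prod>i\<in>UNIV. 2 ^ K * (1 + (x $ i) ^ (2 * K)))"
      unfolding q_def prod_power_distrib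
      by (intro prod_mono) (auto simp: one_plus_square_power_le)
    also have "\<dots> = c * (\<Prod>i\<in>UNIV. 1 + (x $ i) ^ (2 * K))"
      unfolding c_def by (simp only: prod.distrib)
    also have "\<dots> \<le> c * norm (poly_eval P x)"
      using c unfolding P norm_of_real by (intro mult_left_mono) auto
    finally show ?thesis .
  qed
  have "closed \<Lambda>"
    unfolding \<Lambda>_def measure_support_def by (auto intro!: closed_Compl open_Union)
  have null: "emeasure (total_variation \<mu>) (- \<Lambda>) = 0"
  proof -
    have "emeasure (total_variation \<mu>) (- \<Lambda>) \<le> total_variation_open \<mu> (- \<Lambda>)"
      using \<open>closed \<Lambda>\<close> by (intro emeasure_total_variation_le) auto
    also have "\<dots> \<le> 0"
      unfolding total_variation_open_def \<Lambda>_def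
      by (rule SUP_least) (auto simp: radon_measure_vanishes_off_support[OF \<mu>])
    finally show ?thesis by simp
  qed
  note sd = uniformly_discrete_summable[OF \<open>r > 0\<close> sep, folded \<Lambda>_def]
  have space: "space (total_variation \<mu>) = UNIV"
    using sets_eq_imp_space_eq[OF sets_total_variation, of \<mu>] by simp
  have "(\<integral>\<^sup>+ x. ennreal (1 / (1 + norm (poly_eval P x))) \<partial>total_variation \<mu>)
      = (\<integral>\<^sup>+ x. ennreal (1 / (1 + norm (poly_eval P x))) * emeasure (total_variation \<mu>) {x} \<partial>count_space \<Lambda>)"
    using sd(1) \<open>closed \<Lambda>\<close> null
    by (intro nn_integral_concentrated_on_countable) (auto simp: space Compl_eq_Diff_UNIV)
  also have "\<dots> \<le> (\<integral>\<^sup>+ x. ennreal (A * c * (\<Prod>i\<in>UNIV. 1 / (1 + (x $ i)\<^sup>2))) \<partial>count_space \<Lambda>)"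
  proof (rule nn_integral_mono)
    fix x assume "x \<in> space (count_space \<Lambda>)"
    then have "emeasure (total_variation \<mu>) {x} \<le> ennreal (A * q x ^ N)"
      using mass by (simp add: \<Lambda>_def q_def)
    then have "ennreal (1 / (1 + norm (poly_eval P x))) * emeasure (total_variation \<mu>) {x}
        \<le> ennreal (1 / (1 + norm (poly_eval P x))) * ennreal (A * q x ^ N)"
      by (rule mult_left_mono) simp
    also have "\<dots> = ennreal (A * q x ^ N / (1 + norm (poly_eval P x)))"
      by (simp add: ennreal_mult'[symmetric])
    also have "\<dots> \<le> ennreal (A * c * (1 / q x))"
    proof (rule ennreal_leI)
      have "q x ^ N * q x \<le> c * (1 + norm (poly_eval P x))"
        using lower[of x] c by (simp add: K_def algebra_simps)
      then have "q x ^ N / (1 + norm (poly_eval P x)) \<le> c * (1 / q x)"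
        using q[of x] by (simp add: divide_simps add_pos_nonneg)
      from mult_left_mono[OF this \<open>A \<ge> 0\<close>]
      show "A * q x ^ N / (1 + norm (poly_eval P x)) \<le> A * c * (1 / q x)"
        by (simp add: mult.assoc)
    qed
    also have "1 / q x = (\<Prod>i\<in>UNIV. 1 / (1 + (x $ i)\<^sup>2))"
      unfolding q_def by (simp add: prod_dividef)
    finally show "ennreal (1 / (1 + norm (poly_eval P x))) * emeasure (total_variation \<mu>) {x}
        \<le> ennreal (A * c * (\<Prod>i\<in>UNIV. 1 / (1 + (x $ i)\<^sup>2)))" .
  qed
  also have "\<dots> < \<infinity>"
    using Infinite_Set_Sum.abs_summable_on_cmult_right[OF sd(2), of "A * c"] \<open>A \<ge> 0\<close> c
    by (subst nn_integral_conv_infsetsum) (auto intro!: mult_nonneg_nonneg prod_nonneg)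
  finally show ?thesis
    unfolding slowly_increasing_def by blast
qed

section \<open>Tempered measures with uniformly discrete support\<close>

theorem theorem4p4:
  fixes \<mu> :: "(real^'d::finite \<Rightarrow> complex) \<Rightarrow> complex"
  assumes "radon_measure \<mu>"
    and "uniformly_discrete (measure_support \<mu>)"
    and "tempered_measure \<mu>"
  shows "slowly_increasing \<mu>"
proof -
  obtain r where r: "r > 0" and disj: "disjoint_family_on (\<lambda>x. ball x r) (measure_support \<mu>)"
    using assms(2) by (auto simp: uniformly_discrete_def)
  have sep: "dist x y \<ge> r" if "x \<in> measure_support \<mu>" "y \<in> measure_support \<mu>" "x \<noteq> y" for x y
  proof (rule ccontr)
    assume "\<not> dist x y \<ge> r"
    then have "y \<in> ball x r \<inter> ball y r" using r by simp
    then show False using disjoint_family_onD[OF disj that] by blast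
  qed
  obtain T where T: "tempered_distribution T" "\<And>\<phi>. \<phi> \<in> Cc \<Longrightarrow> smooth \<phi> \<Longrightarrow> \<mu> \<phi> = T \<phi>"
    using assms(3) by (auto simp: tempered_measure_def)
  \<comment> \<open>The norm is at most the sum of the coordinates, so this width keeps the bump inside \<open>ball x r\<close>.\<close>
  define s where "s = min 1 (r / (2 * real CARD('d)))"
  have "s > 0" using r by (simp add: s_def)
  obtain G :: "nat \<Rightarrow> real \<Rightarrow> real" where G: "G 0 0 = 1"
    "\<And>n t. (G n has_field_derivative G (Suc n) t) (at t)"
    "\<And>n t. \<bar>t\<bar> \<ge> s \<Longrightarrow> G n t = 0"
    using smooth_bump_real[OF \<open>s > 0\<close>] by blast
  have G1: "G n t = 0" if "\<bar>t\<bar> \<ge> 1" for n t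
    using that by (intro G(3)) (auto simp: s_def)
  let ?\<phi> = "\<lambda>x :: real^'d. tensor_bump G x (\<lambda>i. 0)"
  have \<phi>Cc: "?\<phi> x \<in> Cc" for x by (rule tensor_bump_Cc[where G = G, OF G(2,3)])
  obtain A N where A: "A \<ge> 0" "\<And>x. norm (T (?\<phi> x)) \<le> A * (\<Prod>i\<in>UNIV. 1 + (x $ i)\<^sup>2) ^ N"
    using tensor_bump_bounded_by_weight[where G = G, OF T(1) G(2) G1] by blast
  show ?thesis
  proof (rule slowly_increasingI[OF assms(1) r sep _ A(1)])
    fix x assume x: "x \<in> measure_support \<mu>"
    have outside: "?\<phi> x y = 0" if "y \<notin> ball x r" for y
    proof (rule ccontr)
      assume "?\<phi> x y \<noteq> 0"
      then have "\<bar>(y - x) $ i\<bar> \<le> s" for i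
        using tensor_bump_eq_0[where G = G, OF G(3), where y = y and i = i and x = x] by (force simp: not_le)
      then have "(\<Sum>i\<in>UNIV. \<bar>(y - x) $ i\<bar>) \<le> real CARD('d) * s"
        using sum_mono[of UNIV "\<lambda>i. \<bar>(y - x) $ i\<bar>" "\<lambda>i. s"] by simp
      also have "\<dots> \<le> real CARD('d) * (r / (2 * real CARD('d)))"
        by (intro mult_left_mono) (auto simp: s_def)
      also have "\<dots> < r" using r by simp
      finally have "dist x y < r"
        using norm_le_l1_cart[of "y - x"] by (simp add: dist_norm norm_minus_commute)
      then show False using that by simp
    qed
    have "emeasure (total_variation \<mu>) {x} \<le> total_variation_open \<mu> (ball x r)"
      using r by (intro emeasure_total_variation_le) auto
    also have "\<dots> \<le> ennreal (norm (\<mu> (?\<phi> x)))"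
    proof (rule mass_near_isolated_point[OF assms(1) _ \<phi>Cc])
      show "ball x r \<inter> measure_support \<mu> \<subseteq> {x}"
        using sep[OF x] by force
      show "?\<phi> x x = 1" by (simp add: tensor_bump_def G(1))
    qed (rule outside)
    also have "\<mu> (?\<phi> x) = T (?\<phi> x)"
      by (intro T(2) \<phi>Cc smooth_tensor_bump[where G = G, OF G(2)])
    also have "ennreal (norm (T (?\<phi> x))) \<le> ennreal (A * (\<Prod>i\<in>UNIV. 1 + (x $ i)\<^sup>2) ^ N)"
      by (intro ennreal_leI A(2))
    finally show "emeasure (total_variation \<mu>) {x} \<le> ennreal (A * (\<Prod>i\<in>UNIV. 1 + (x $ i)\<^sup>2) ^ N)" .
  qed
qed

end
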